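(* For all integers $l,k\ge0$, the additional flow $\partial_{t^*_{l,k}}$ of the BKP hierarchy, defined by $\partial_{t^*_{l,k}}\Phi_B=-(D_{lk})_-\Phi_B$, is a symmetry of the BKP hierarchy; that is, it commutes with all flows $\partial_{t_n}$ ($n\ge1$ odd) of the BKP hierarchy.
   Context: Work with (formal) pseudo-differential operators in $\partial=\partial/\partial x$, with product given by $\partial^n\circ f=\sum_{j\ge 0}\binom nj(\partial^jf)\partial^{n-j}$, $n\in\mathbb Z$. The conjugation is $\big(\sum_ip_i\partial^i\big)^*=\sum_i(-\partial)^ip_i$. $A_+$ is the part of $A$ with powers $\partial^i$, $i\ge0$, and $A_-=A-A_+$. BKP hierarchy: $\mathcal L_B=\partial+\sum_{i\ge1}v_i\partial^{-i}$, with coefficients depending on $t=(t_1,t_3,t_5,\dots)$, $t_1=x$, satisfies $\mathcal L_B^*=-\partial\mathcal L_B\partial^{-1}$ and $\partial\mathcal L_B/\partial t_k=[(\mathcal L_B^k)_+,\mathcal L_B]$ for odd $k\ge1$. It is written $\mathcal L_B=\Phi_B\partial\Phi_B^{-1}$, with $\Phi_B=1+\sum_{k\ge1}\bar\omega_k\partial^{-k}$ satisfying $\Phi_B^*=\partial\Phi_B^{-1}\partial^{-1}$ and $\partial\Phi_B/\partial t_n=-(\mathcal L_B^n)_-\Phi_B$ for odd $n\ge1$. The Orlov–Shulman operator is $\mathcal M_B=\Phi_B\Gamma_B\Phi_B^{-1}$, with $\Gamma_B=\sum_{i\ge1,\,i\text{ odd}}it_i\partial^{i-1}$; $[\mathcal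 L_B,\mathcal M_B]=1$. For $m,n\ge0$ and a parameter $q$ put $$B_{mn}=\mathcal M_B^m\mathcal L_B^n-(-1)^n\mathcal L_B^{n-1}\mathcal M_B^m\mathcal L_B,\qquad D_{mn}=e^{m\mathcal M_B}q^{n\mathcal L_B}-\mathcal L_B^{-1}q^{-n\mathcal L_B}e^{m\mathcal M_B}\mathcal L_B,$$ understood as the formal series $D_{mn}=\sum_{p,s\ge0}\frac{m^p(n\log q)^s}{p!\,s!}B_{ps}$. The additional flows are defined by $\partial_{t_{m,n}}\Phi_B=-(B_{mn})_-\Phi_B$ and $\partial_{t^*_{m,n}}\Phi_B=-(D_{mn})_-\Phi_B$. *)

theory Defs
  imports
    Complex_Main
    "HOL-Library.Poly_Mapping"
    "HOL-Computational_Algebra.Formal_Power_Series"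
begin

section \<open>Formal pseudo-differential operators over a differential algebra\<close>

class differential_algebra = comm_ring_1 + real_algebra_1 +
  fixes dx :: "'a \<Rightarrow> 'a"
  assumes dx_add: "dx (a + b) = dx a + dx b"
    and dx_scaleR: "dx (scaleR c a) = scaleR c (dx a)"
    and dx_mult: "dx (a * b) = dx a * b + a * dx b"
begin

lemma dx_0 [simp]: "dx 0 = 0"
  using dx_add[of 0 0] by simp

lemma dx_1 [simp]: "dx 1 = 0"
  using dx_mult[of 1 1] by simp

lemma dx_sum: "dx (sum f A) = (\<Sum>i\<in>A. dx (f i))"
  by (induction A rule: infinite_finite_induct) (auto simp: dx_add)

lemma dx_pow_0 [simp]: "(dx ^^ r) 0 = 0"
  by (induction r) auto

lemma dx_pow_1: "(dx ^^ r) 1 = (if r = 0 then 1 else 0)"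
  by (induction r) auto

lemma dx_pow_add: "(dx ^^ r) (a + b) = (dx ^^ r) a + (dx ^^ r) b"
  by (induction r) (auto simp: dx_add)

lemma dx_pow_scaleR: "(dx ^^ r) (scaleR c a) = scaleR c ((dx ^^ r) a)"
  by (induction r) (auto simp: dx_scaleR)

lemma dx_pow_sum: "(dx ^^ r) (sum f A) = (\<Sum>i\<in>A. (dx ^^ r) (f i))"
  by (induction A rule: infinite_finite_induct) (auto simp: dx_pow_add)

end

lemma dx_pow_mult:
  fixes a b :: "'a::differential_algebra"
  shows "(dx ^^ n) (a * b) = (\<Sum>r\<le>n. real (n choose r) *\<^sub>R ((dx ^^ r) a * (dx ^^ (n - r)) b))"
proof (induction n)
  case (Suc n)
  have "(dx ^^ Suc n) (a * b)
      = (\<Sum>r\<le>n. real (n choose r) *\<^sub>R ((dx ^^ Suc r) a * (dx ^^ (n - r)) b))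
      + (\<Sum>r\<le>n. real (n choose r) *\<^sub>R ((dx ^^ r) a * (dx ^^ (Suc n - r)) b))"
    by (simp add: Suc dx_sum dx_scaleR dx_mult scaleR_add_right sum.distrib Suc_diff_le)
  also have "(\<Sum>r\<le>n. real (n choose r) *\<^sub>R ((dx ^^ r) a * (dx ^^ (Suc n - r)) b))
      = (\<Sum>r\<le>Suc n. real (n choose r) *\<^sub>R ((dx ^^ r) a * (dx ^^ (Suc n - r)) b))"
    by simp
  also have "\<dots> = a * (dx ^^ Suc n) b
      + (\<Sum>r\<le>n. real (n choose Suc r) *\<^sub>R ((dx ^^ Suc r) a * (dx ^^ (n - r)) b))"
    by (subst sum.atMost_Suc_shift) simp
  also have "(\<Sum>r\<le>n. real (n choose r) *\<^sub>R ((dx ^^ Suc r) a * (dx ^^ (n - r)) b)) + \<dots>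
      = a * (dx ^^ Suc n) b
      + (\<Sum>r\<le>n. real (Suc n choose Suc r) *\<^sub>R ((dx ^^ Suc r) a * (dx ^^ (n - r)) b))"
    by (simp add: sum.distrib scaleR_add_left)
  also have "\<dots> = (\<Sum>r\<le>Suc n. real (Suc n choose r) *\<^sub>R ((dx ^^ r) a * (dx ^^ (Suc n - r)) b))"
    unfolding sum.atMost_Suc_shift[of _ n] by simp
  finally show ?case .
qed simp

typedef (overloaded) 'a psdo = "{f :: int \<Rightarrow> 'a::zero. \<exists>N. \<forall>i>N. f i = 0}"
  morphisms coeff_psdo Abs_psdo
  by (rule exI[of _ "\<lambda>_. 0"]) simp

setup_lifting type_definition_psdo

lemma psdo_eqI: "(\<And>k. coeff_psdo P k = coeff_psdo Q k) \<Longrightarrow> P = Q"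
  by (simp add: coeff_psdo_inject[symmetric] fun_eq_iff)

lemma coeff_psdo_bound: "\<exists>N\<ge>0. \<forall>i>N. coeff_psdo P i = 0"
proof -
  obtain M where M: "\<forall>i>M. coeff_psdo P i = 0"
    using coeff_psdo[of P] by blast
  then show ?thesis by (intro exI[of _ "max M 0"]) auto
qed

text \<open>
  The coefficient of the product \<open>P \<circ> Q\<close> at \<open>\<partial>\<^sup>k\<close>, obtained by collecting the terms of
  \<open>p\<^sub>i \<partial>\<^sup>i \<circ> q\<^sub>j \<partial>\<^sup>j = \<Sum>\<^sub>r binom(i, r) p\<^sub>i q\<^sub>j\<^sup>(\<^sup>r\<^sup>) \<partial>\<^sup>i\<^sup>+\<^sup>j\<^sup>-\<^sup>r\<close> with \<open>i + j - r = k\<close>.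
  Only finitely many terms are nonzero.
\<close>

definition psdo_mult_coeff :: "(int \<Rightarrow> 'a) \<Rightarrow> (int \<Rightarrow> 'a) \<Rightarrow> int \<Rightarrow> 'a::differential_algebra" where
  "psdo_mult_coeff p q k =
    Sum_any (\<lambda>(i, r). ((of_int i :: real) gchoose r) *\<^sub>R (p i * (dx ^^ r) (q (k - i + int r))))"

lemma psdo_mult_coeff_bound:
  assumes "\<And>i. i > N \<Longrightarrow> p i = 0" "\<And>i. i > M \<Longrightarrow> q i = 0" "k > N + M"
  shows "psdo_mult_coeff p q k = 0"
proof -
  have "(\<lambda>(i, r). ((of_int i :: real) gchoose r) *\<^sub>R (p i * (dx ^^ r) (q (k - i + int r)))) = (\<lambda>_. 0)"
  proof (rule ext, clarify)
    fix i :: int and r :: nat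
    consider "i > N" | "k - i + int r > M" using assms(3) by linarith
    then show "((of_int i :: real) gchoose r) *\<^sub>R (p i * (dx ^^ r) (q (k - i + int r))) = 0"
      by cases (auto simp: assms)
  qed
  then show ?thesis by (simp add: psdo_mult_coeff_def)
qed

definition gch :: "int \<Rightarrow> int \<Rightarrow> real" where
  "gch i d = (if d < 0 then 0 else of_int i gchoose nat d)"

lemma psdo_mult_coeff_box:
  fixes p q :: "int \<Rightarrow> 'a::differential_algebra"
  assumes p: "\<And>i. i > N \<Longrightarrow> p i = 0" and q: "\<And>i. i > M \<Longrightarrow> q i = 0"
    and fin: "finite I" "finite J"
    and I: "\<And>i. k - M \<le> i \<Longrightarrow> i \<le> N \<Longrightarrow> i \<in> I"
    and J: "\<And>j. k - N \<le> j \<Longrightarrow> j \<le> M \<Longrightarrow> j \<in> J"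
  shows "psdo_mult_coeff p q k
    = (\<Sum>i\<in>I. \<Sum>j\<in>J. gch i (i + j - k) *\<^sub>R (p i * (dx ^^ nat (i + j - k)) (q j)))"
proof -
  let ?t = "\<lambda>(i, r). ((of_int i :: real) gchoose r) *\<^sub>R (p i * (dx ^^ r) (q (k - i + int r)))"
  let ?S = "{(i, r). i \<in> I \<and> k - i + int r \<in> J}"
  let ?B = "{(i, j). i \<in> I \<and> j \<in> J \<and> i + j \<ge> k}"
  have finB: "finite ?B"
    by (rule finite_subset[of _ "I \<times> J"]) (auto simp: fin)
  have bij: "bij_betw (\<lambda>(i, j). (i, nat (i + j - k))) ?B ?S"
    by (rule bij_betw_byWitness[where f' = "\<lambda>(i, r). (i, k - i + int r)"]) auto
  have finS: "finite ?S"
    using bij finB bij_betw_finite by blast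
  have sub: "{a. ?t a \<noteq> 0} \<subseteq> ?S"
  proof clarify
    fix i :: int and r :: nat
    assume nz: "((of_int i :: real) gchoose r) *\<^sub>R (p i * (dx ^^ r) (q (k - i + int r))) \<noteq> 0"
    have "i \<le> N" using nz p[of i] by fastforce
    moreover have "k - i + int r \<le> M" using nz q[of "k - i + int r"] by fastforce
    ultimately show "i \<in> I \<and> k - i + int r \<in> J"
      using I[of i] J[of "k - i + int r"] by auto
  qed
  have "psdo_mult_coeff p q k = sum ?t ?S"
    unfolding psdo_mult_coeff_def by (rule Sum_any.expand_superset[OF finS sub])
  also have "\<dots> = (\<Sum>(i, j)\<in>?B. ?t (i, nat (i + j - k)))"
    by (subst sum.reindex_bij_betw[OF bij, symmetric]) (simp add: case_prod_beta)
  also have "\<dots> = (\<Sum>(i, j)\<in>?B. gch i (i + j - k) *\<^sub>R (p i * (dx ^^ nat (i + j - k)) (q j)))"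
    by (rule sum.cong) (auto simp: gch_def)
  also have "\<dots> = (\<Sum>(i, j)\<in>I \<times> J. gch i (i + j - k) *\<^sub>R (p i * (dx ^^ nat (i + j - k)) (q j)))"
    by (rule sum.mono_neutral_left) (auto simp: fin gch_def split: if_splits)
  finally show ?thesis by (simp add: sum.cartesian_product)
qed

instantiation psdo :: (comm_ring_1) ab_group_add
begin

lift_definition zero_psdo :: "'a psdo" is "\<lambda>_. 0" by simp

lift_definition plus_psdo :: "'a psdo \<Rightarrow> 'a psdo \<Rightarrow> 'a psdo" is "\<lambda>p q i. p i + q i"
proof -
  fix p q :: "int \<Rightarrow> 'a"
  assume "\<exists>N. \<forall>i>N. p i = 0" "\<exists>N. \<forall>i>N. q i = 0"
  then obtain N M where "\<forall>i>N. p i = 0" "\<forall>i>M. q i = 0" by blast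
  then show "\<exists>N. \<forall>i>N. p i + q i = 0" by (intro exI[of _ "max N M"]) auto
qed

lift_definition uminus_psdo :: "'a psdo \<Rightarrow> 'a psdo" is "\<lambda>p i. - p i" by simp

definition minus_psdo :: "'a psdo \<Rightarrow> 'a psdo \<Rightarrow> 'a psdo" where
  "minus_psdo P Q = P + - Q"

instance
  by standard (auto simp: minus_psdo_def intro!: psdo_eqI,
      auto simp: plus_psdo.rep_eq zero_psdo.rep_eq uminus_psdo.rep_eq algebra_simps)

end

lemma gch_trinomial:
  fixes i j :: int and n r :: nat
  assumes "r \<le> n"
  shows "(\<Sum>p\<in>{r..n}. (of_int i gchoose p) * (of_int j gchoose (n - p)) * real (p choose r))
    = ((of_int (i + j - int r) :: real) gchoose (n - r)) * (of_int i gchoose r)"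
proof -
  have "(\<Sum>p\<in>{r..n}. (of_int i gchoose p) * (of_int j gchoose (n - p)) * real (p choose r))
      = (\<Sum>p\<in>{r..n}. ((of_int i :: real) gchoose r)
          * ((of_int i - of_nat r gchoose (p - r)) * (of_int j gchoose (n - p))))"
  proof (rule sum.cong)
    fix p assume "p \<in> {r..n}"
    then show "(of_int i gchoose p) * (of_int j gchoose (n - p)) * real (p choose r)
      = ((of_int i :: real) gchoose r) * ((of_int i - of_nat r gchoose (p - r)) * (of_int j gchoose (n - p)))"
      using gbinomial_trinomial_revision[of r p "of_int i :: real"]
      by (simp add: binomial_gbinomial algebra_simps)
  qed simp
  also have "\<dots> = ((of_int i :: real) gchoose r)
      * (\<Sum>p\<in>{r..n}. (of_int i - of_nat r gchoose (p - r)) * (of_int j gchoose (n - p)))"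
    by (simp add: sum_distrib_left)
  also have "(\<Sum>p\<in>{r..n}. ((of_int i :: real) - of_nat r gchoose (p - r)) * (of_int j gchoose (n - p)))
      = (\<Sum>u\<in>{0..n - r}. ((of_int i :: real) - of_nat r gchoose u) * (of_int j gchoose (n - r - u)))"
    by (rule sum.reindex_bij_witness[where i = "\<lambda>u. u + r" and j = "\<lambda>p. p - r"])
      (use assms in \<open>auto simp: add.commute\<close>)
  also have "\<dots> = ((of_int i :: real) - of_nat r + of_int j) gchoose (n - r)"
    by (rule gbinomial_Vandermonde)
  finally show ?thesis by (simp add: algebra_simps)
qed

lemma psdo_assoc_key:
  fixes g h :: "'a::differential_algebra" and A :: "int set"
  assumes fin: "finite A"
    and A1: "\<And>r. r \<le> n \<Longrightarrow> i + j - int r \<in> A"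
    and A2: "\<And>p. p \<le> n \<Longrightarrow> k - i + int p \<in> A"
    and n: "int n = i + j + l - k"
  shows "(\<Sum>a\<in>A. (gch a (a + l - k) * gch i (i + j - a))
            *\<^sub>R ((dx ^^ nat (i + j - a)) g * (dx ^^ nat (a + l - k)) h))
       = (\<Sum>b\<in>A. (gch i (i + b - k) * gch j (j + l - b))
            *\<^sub>R (dx ^^ nat (i + b - k)) (g * (dx ^^ nat (j + l - b)) h))"
proof -
  have "(\<Sum>a\<in>A. (gch a (a + l - k) * gch i (i + j - a))
            *\<^sub>R ((dx ^^ nat (i + j - a)) g * (dx ^^ nat (a + l - k)) h))
      = (\<Sum>a\<in>(\<lambda>r. i + j - int r) ` {..n}. (gch a (a + l - k) * gch i (i + j - a))
            *\<^sub>R ((dx ^^ nat (i + j - a)) g * (dx ^^ nat (a + l - k)) h))"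
  proof (rule sum.mono_neutral_right)
    show "\<forall>a\<in>A - (\<lambda>r. i + j - int r) ` {..n}. (gch a (a + l - k) * gch i (i + j - a))
            *\<^sub>R ((dx ^^ nat (i + j - a)) g * (dx ^^ nat (a + l - k)) h) = 0"
    proof
      fix a assume a: "a \<in> A - (\<lambda>r. i + j - int r) ` {..n}"
      have "a + l - k < 0 \<or> i + j - a < 0"
      proof (rule ccontr)
        assume "\<not> ?thesis"
        then have "a = i + j - int (nat (i + j - a))" "nat (i + j - a) \<le> n" using n by auto
        then show False using a by blast
      qed
      then show "(gch a (a + l - k) * gch i (i + j - a))
            *\<^sub>R ((dx ^^ nat (i + j - a)) g * (dx ^^ nat (a + l - k)) h) = 0"
        by (auto simp: gch_def)
    qed
  qed (use fin A1 in auto)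
  also have "\<dots> = (\<Sum>r\<le>n. ((of_int (i + j - int r) gchoose (n - r)) * (of_int i gchoose r))
            *\<^sub>R ((dx ^^ r) g * (dx ^^ (n - r)) h))"
  proof (subst sum.reindex, simp add: inj_on_def, rule sum.cong)
    fix r assume r: "r \<in> {..n}"
    have "i + j - int r + l - k = int (n - r)" using n r by auto
    then show "((\<lambda>a. (gch a (a + l - k) * gch i (i + j - a))
            *\<^sub>R ((dx ^^ nat (i + j - a)) g * (dx ^^ nat (a + l - k)) h)) \<circ> (\<lambda>r. i + j - int r)) r
        = ((of_int (i + j - int r) gchoose (n - r)) * (of_int i gchoose r))
            *\<^sub>R ((dx ^^ r) g * (dx ^^ (n - r)) h)"
      by (simp add: gch_def del: of_int_add of_int_diff)
  qed simp
  also have "\<dots> = (\<Sum>r\<le>n. (\<Sum>p\<in>{r..n}. (of_int i gchoose p) * (of_int j gchoose (n - p)) * real (p choose r))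
            *\<^sub>R ((dx ^^ r) g * (dx ^^ (n - r)) h))"
    by (rule sum.cong[OF refl], subst gch_trinomial) auto
  also have "\<dots> = (\<Sum>r\<le>n. \<Sum>p\<in>{r..n}. ((of_int i gchoose p) * (of_int j gchoose (n - p)) * real (p choose r))
            *\<^sub>R ((dx ^^ r) g * (dx ^^ (n - r)) h))"
    by (simp add: scaleR_sum_left)
  also have "\<dots> = (\<Sum>p\<le>n. \<Sum>r\<le>p. ((of_int i gchoose p) * (of_int j gchoose (n - p)) * real (p choose r))
            *\<^sub>R ((dx ^^ r) g * (dx ^^ (n - r)) h))"
    unfolding sum.Sigma[OF finite_atMost ballI[OF finite_atLeastAtMost]]
      sum.Sigma[OF finite_atMost ballI[OF finite_atMost]]
    by (rule sum.reindex_bij_witness[where i = "\<lambda>(a, b). (b, a)" and j = "\<lambda>(a, b). (b, a)"]) auto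
  also have "\<dots> = (\<Sum>p\<le>n. ((of_int i gchoose p) * (of_int j gchoose (n - p)))
            *\<^sub>R (dx ^^ p) (g * (dx ^^ (n - p)) h))"
  proof (rule sum.cong[OF refl])
    fix p assume p: "p \<in> {..n}"
    have "(dx ^^ (p - r)) ((dx ^^ (n - p)) h) = (dx ^^ (n - r)) h" if "r \<le> p" for r
      using that p funpow_add[of "p - r" "n - p" "dx :: 'a \<Rightarrow> 'a"] by (simp add: fun_eq_iff)
    then show "(\<Sum>r\<le>p. ((of_int i gchoose p) * (of_int j gchoose (n - p)) * real (p choose r))
            *\<^sub>R ((dx ^^ r) g * (dx ^^ (n - r)) h))
       = ((of_int i gchoose p) * (of_int j gchoose (n - p)))
            *\<^sub>R (dx ^^ p) (g * (dx ^^ (n - p)) h)"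
      by (simp add: dx_pow_mult scaleR_sum_right)
  qed
  also have "\<dots> = (\<Sum>b\<in>(\<lambda>p. k - i + int p) ` {..n}. (gch i (i + b - k) * gch j (j + l - b))
            *\<^sub>R (dx ^^ nat (i + b - k)) (g * (dx ^^ nat (j + l - b)) h))"
  proof (subst sum.reindex, simp add: inj_on_def, rule sum.cong)
    fix p assume p: "p \<in> {..n}"
    have "j + l - (k - i + int p) = int (n - p)" using n p by auto
    then show "((of_int i gchoose p) * (of_int j gchoose (n - p)))
            *\<^sub>R (dx ^^ p) (g * (dx ^^ (n - p)) h)
        = ((\<lambda>b. (gch i (i + b - k) * gch j (j + l - b))
            *\<^sub>R (dx ^^ nat (i + b - k)) (g * (dx ^^ nat (j + l - b)) h)) \<circ> (\<lambda>p. k - i + int p)) p"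
      by (simp add: gch_def)
  qed simp
  also have "\<dots> = (\<Sum>b\<in>A. (gch i (i + b - k) * gch j (j + l - b))
            *\<^sub>R (dx ^^ nat (i + b - k)) (g * (dx ^^ nat (j + l - b)) h))"
  proof (rule sum.mono_neutral_left)
    show "\<forall>b\<in>A - (\<lambda>p. k - i + int p) ` {..n}. (gch i (i + b - k) * gch j (j + l - b))
            *\<^sub>R (dx ^^ nat (i + b - k)) (g * (dx ^^ nat (j + l - b)) h) = 0"
    proof
      fix b assume b: "b \<in> A - (\<lambda>p. k - i + int p) ` {..n}"
      have "i + b - k < 0 \<or> j + l - b < 0"
      proof (rule ccontr)
        assume "\<not> ?thesis"
        then have "b = k - i + int (nat (i + b - k))" "nat (i + b - k) \<le> n" using n by auto
        then show False using b by blast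
      qed
      then show "(gch i (i + b - k) * gch j (j + l - b))
            *\<^sub>R (dx ^^ nat (i + b - k)) (g * (dx ^^ nat (j + l - b)) h) = 0"
        by (auto simp: gch_def)
    qed
  qed (use fin A2 in auto)
  finally show ?thesis .
qed

instantiation psdo :: (differential_algebra) ring_1
begin

lift_definition one_psdo :: "'a psdo" is "\<lambda>i. if i = 0 then 1 else 0"
  by (rule exI[of _ 0]) simp

lift_definition times_psdo :: "'a psdo \<Rightarrow> 'a psdo \<Rightarrow> 'a psdo" is psdo_mult_coeff
proof -
  fix p q :: "int \<Rightarrow> 'a"
  assume "\<exists>N. \<forall>i>N. p i = 0" "\<exists>N. \<forall>i>N. q i = 0"
  then obtain N M where "\<forall>i>N. p i = 0" "\<forall>i>M. q i = 0" by blast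
  then show "\<exists>N. \<forall>i>N. psdo_mult_coeff p q i = 0"
    by (intro exI[of _ "N + M"]) (auto intro!: psdo_mult_coeff_bound[of N p M q])
qed

instance
proof
  fix P Q R :: "'a psdo"
  obtain N1 where N1: "N1 \<ge> 0" "\<And>i. i > N1 \<Longrightarrow> coeff_psdo P i = 0" using coeff_psdo_bound[of P] by blast
  obtain N2 where N2: "N2 \<ge> 0" "\<And>i. i > N2 \<Longrightarrow> coeff_psdo Q i = 0" using coeff_psdo_bound[of Q] by blast
  obtain N3 where N3: "N3 \<ge> 0" "\<And>i. i > N3 \<Longrightarrow> coeff_psdo R i = 0" using coeff_psdo_bound[of R] by blast
  define N where "N = max N1 (max N2 N3)"
  have N: "N \<ge> 0" and bP: "\<And>i. i > N \<Longrightarrow> coeff_psdo P i = 0"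
    and bQ: "\<And>i. i > N \<Longrightarrow> coeff_psdo Q i = 0" and bR: "\<And>i. i > N \<Longrightarrow> coeff_psdo R i = 0"
    using N1 N2 N3 by (auto simp: N_def)
  show "P * Q * R = P * (Q * R)"
  proof (rule psdo_eqI)
    fix k
    define A where "A = {k - N..2 * N}"
    define B where "B = {k - 2 * N..N}"
    let ?p = "coeff_psdo P" and ?q = "coeff_psdo Q" and ?r = "coeff_psdo R"
    have PQ: "coeff_psdo (P * Q) a
        = (\<Sum>i\<in>B. \<Sum>j\<in>B. gch i (i + j - a) *\<^sub>R (?p i * (dx ^^ nat (i + j - a)) (?q j)))"
      if "a \<in> A" for a
      unfolding times_psdo.rep_eq
      by (rule psdo_mult_coeff_box[OF bP bQ]) (use that in \<open>auto simp: A_def B_def\<close>)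
    have QR: "coeff_psdo (Q * R) b
        = (\<Sum>j\<in>B. \<Sum>l\<in>B. gch j (j + l - b) *\<^sub>R (?q j * (dx ^^ nat (j + l - b)) (?r l)))"
      if "b \<in> A" for b
      unfolding times_psdo.rep_eq
      by (rule psdo_mult_coeff_box[OF bQ bR]) (use that in \<open>auto simp: A_def B_def\<close>)
    have bPQ: "coeff_psdo (P * Q) a = 0" if "a > 2 * N" for a
      unfolding times_psdo.rep_eq
      by (rule psdo_mult_coeff_bound[OF bP bQ]) (use that in auto)
    have bQR: "coeff_psdo (Q * R) b = 0" if "b > 2 * N" for b
      unfolding times_psdo.rep_eq
      by (rule psdo_mult_coeff_bound[OF bQ bR]) (use that in auto)
    have "coeff_psdo (P * Q * R) k
        = (\<Sum>a\<in>A. \<Sum>l\<in>B. gch a (a + l - k) *\<^sub>R (coeff_psdo (P * Q) a * (dx ^^ nat (a + l - k)) (?r l)))"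
      unfolding times_psdo.rep_eq[of "P * Q"]
      by (rule psdo_mult_coeff_box[OF bPQ bR]) (use N in \<open>auto simp: A_def B_def\<close>)
    also have "\<dots> = (\<Sum>a\<in>A. \<Sum>l\<in>B. \<Sum>i\<in>B. \<Sum>j\<in>B. ?p i * ((gch a (a + l - k) * gch i (i + j - a))
            *\<^sub>R ((dx ^^ nat (i + j - a)) (?q j) * (dx ^^ nat (a + l - k)) (?r l))))"
      by (simp add: PQ sum_distrib_right scaleR_sum_right mult.assoc)
    also have "\<dots> = (\<Sum>l\<in>B. \<Sum>i\<in>B. \<Sum>j\<in>B. \<Sum>a\<in>A. ?p i * ((gch a (a + l - k) * gch i (i + j - a))
            *\<^sub>R ((dx ^^ nat (i + j - a)) (?q j) * (dx ^^ nat (a + l - k)) (?r l))))"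
      by (rule trans[OF sum.swap], rule sum.cong[OF refl], rule trans[OF sum.swap],
          rule sum.cong[OF refl], rule sum.swap)
    also have "\<dots> = (\<Sum>l\<in>B. \<Sum>i\<in>B. \<Sum>j\<in>B. \<Sum>b\<in>A. ?p i * ((gch i (i + b - k) * gch j (j + l - b))
            *\<^sub>R (dx ^^ nat (i + b - k)) (?q j * (dx ^^ nat (j + l - b)) (?r l))))"
    proof (rule sum.cong[OF refl], rule sum.cong[OF refl], rule sum.cong[OF refl])
      fix l i j assume B: "l \<in> B" "i \<in> B" "j \<in> B"
      show "(\<Sum>a\<in>A. ?p i * ((gch a (a + l - k) * gch i (i + j - a))
            *\<^sub>R ((dx ^^ nat (i + j - a)) (?q j) * (dx ^^ nat (a + l - k)) (?r l))))
        = (\<Sum>b\<in>A. ?p i * ((gch i (i + b - k) * gch j (j + l - b))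
            *\<^sub>R (dx ^^ nat (i + b - k)) (?q j * (dx ^^ nat (j + l - b)) (?r l))))"
      proof (cases "i + j + l - k \<ge> 0")
        case True
        have "(\<Sum>a\<in>A. (gch a (a + l - k) * gch i (i + j - a))
            *\<^sub>R ((dx ^^ nat (i + j - a)) (?q j) * (dx ^^ nat (a + l - k)) (?r l)))
          = (\<Sum>b\<in>A. (gch i (i + b - k) * gch j (j + l - b))
            *\<^sub>R (dx ^^ nat (i + b - k)) (?q j * (dx ^^ nat (j + l - b)) (?r l)))"
          by (rule psdo_assoc_key[where n = "nat (i + j + l - k)"])
            (use True B in \<open>auto simp: A_def B_def\<close>)
        then show ?thesis by (simp only: sum_distrib_left[symmetric])
      next
        case False
        have "gch a (a + l - k) * gch i (i + j - a) = 0" for a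
          using False by (auto simp: gch_def)
        moreover have "gch i (i + b - k) * gch j (j + l - b) = 0" for b
          using False by (auto simp: gch_def)
        ultimately show ?thesis by (simp only: scaleR_zero_left mult_zero_right)
      qed
    qed
    also have "\<dots> = (\<Sum>i\<in>B. \<Sum>b\<in>A. \<Sum>j\<in>B. \<Sum>l\<in>B. ?p i * ((gch i (i + b - k) * gch j (j + l - b))
            *\<^sub>R (dx ^^ nat (i + b - k)) (?q j * (dx ^^ nat (j + l - b)) (?r l))))"
    proof (rule trans[OF sum.swap], rule sum.cong[OF refl])
      fix i
      let ?T = "\<lambda>l j b. ?p i * ((gch i (i + b - k) * gch j (j + l - b))
            *\<^sub>R (dx ^^ nat (i + b - k)) (?q j * (dx ^^ nat (j + l - b)) (?r l)))"
      have "(\<Sum>l\<in>B. \<Sum>j\<in>B. \<Sum>b\<in>A. ?T l j b) = (\<Sum>l\<in>B. \<Sum>b\<in>A. \<Sum>j\<in>B. ?T l j b)"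
        by (rule sum.cong[OF refl], rule sum.swap)
      also have "\<dots> = (\<Sum>b\<in>A. \<Sum>l\<in>B. \<Sum>j\<in>B. ?T l j b)" by (rule sum.swap)
      also have "\<dots> = (\<Sum>b\<in>A. \<Sum>j\<in>B. \<Sum>l\<in>B. ?T l j b)"
        by (rule sum.cong[OF refl], rule sum.swap)
      finally show "(\<Sum>l\<in>B. \<Sum>j\<in>B. \<Sum>b\<in>A. ?T l j b) = (\<Sum>b\<in>A. \<Sum>j\<in>B. \<Sum>l\<in>B. ?T l j b)" .
    qed
    also have "\<dots> = (\<Sum>i\<in>B. \<Sum>b\<in>A. gch i (i + b - k) *\<^sub>R (?p i * (dx ^^ nat (i + b - k)) (coeff_psdo (Q * R) b)))"
      by (simp add: QR dx_pow_sum dx_pow_scaleR sum_distrib_left scaleR_sum_right)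
    also have "\<dots> = coeff_psdo (P * (Q * R)) k"
      unfolding times_psdo.rep_eq[of P]
      by (rule psdo_mult_coeff_box[OF bP bQR, symmetric]) (use N in \<open>auto simp: A_def B_def\<close>)
    finally show "coeff_psdo (P * Q * R) k = coeff_psdo (P * (Q * R)) k" .
  qed
  have b: "\<forall>i>N. coeff_psdo P i = 0" "\<forall>i>N. coeff_psdo Q i = 0" "\<forall>i>N. coeff_psdo R i = 0"
    "\<forall>i>N. coeff_psdo (P + Q) i = 0" "\<forall>i>N. coeff_psdo (Q + R) i = 0"
    using bP bQ bR by (auto simp: plus_psdo.rep_eq)
  show "(P + Q) * R = P * R + Q * R"
  proof (rule psdo_eqI)
    fix k
    define B where "B = {k - N..N}"
    have *: "coeff_psdo (X * Y) k = (\<Sum>i\<in>B. \<Sum>j\<in>B. gch i (i + j - k)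
          *\<^sub>R (coeff_psdo X i * (dx ^^ nat (i + j - k)) (coeff_psdo Y j)))"
      if "\<forall>i>N. coeff_psdo X i = 0" "\<forall>i>N. coeff_psdo Y i = 0" for X Y :: "'a psdo"
      unfolding times_psdo.rep_eq
      by (rule psdo_mult_coeff_box[of N _ N]) (use that in \<open>auto simp: B_def\<close>)
    show "coeff_psdo ((P + Q) * R) k = coeff_psdo (P * R + Q * R) k"
      unfolding plus_psdo.rep_eq[of "P * R"] *[OF b(4,3)] *[OF b(1,3)] *[OF b(2,3)]
      by (simp add: plus_psdo.rep_eq distrib_right scaleR_add_right sum.distrib)
  qed
  show "P * (Q + R) = P * Q + P * R"
  proof (rule psdo_eqI)
    fix k
    define B where "B = {k - N..N}"
    have *: "coeff_psdo (X * Y) k = (\<Sum>i\<in>B. \<Sum>j\<in>B. gch i (i + j - k)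
          *\<^sub>R (coeff_psdo X i * (dx ^^ nat (i + j - k)) (coeff_psdo Y j)))"
      if "\<forall>i>N. coeff_psdo X i = 0" "\<forall>i>N. coeff_psdo Y i = 0" for X Y :: "'a psdo"
      unfolding times_psdo.rep_eq
      by (rule psdo_mult_coeff_box[of N _ N]) (use that in \<open>auto simp: B_def\<close>)
    show "coeff_psdo (P * (Q + R)) k = coeff_psdo (P * Q + P * R) k"
      unfolding plus_psdo.rep_eq[of "P * Q"] *[OF b(1,5)] *[OF b(1,2)] *[OF b(1,3)]
      by (simp add: plus_psdo.rep_eq distrib_left dx_pow_add scaleR_add_right sum.distrib)
  qed
  have b1: "\<And>i. i > 0 \<Longrightarrow> coeff_psdo (1 :: 'a psdo) i = 0"
    by (simp add: one_psdo.rep_eq)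
  show "1 * P = P"
  proof (rule psdo_eqI)
    fix k
    define t where "t = (\<lambda>(i, r). ((of_int i :: real) gchoose r)
        *\<^sub>R (coeff_psdo (1 :: 'a psdo) i * (dx ^^ r) (coeff_psdo P (k - i + int r))))"
    have "t a = (if a = (0, 0) then coeff_psdo P k else 0)" for a
      by (cases a; cases "snd a") (auto simp: t_def one_psdo.rep_eq)
    then have "t = (\<lambda>a. if a = (0, 0) then coeff_psdo P k else 0)" by blast
    then show "coeff_psdo (1 * P) k = coeff_psdo P k"
      unfolding times_psdo.rep_eq psdo_mult_coeff_def t_def[symmetric] by simp
  qed
  show "P * 1 = P"
  proof (rule psdo_eqI)
    fix k
    define t where "t = (\<lambda>(i, r). ((of_int i :: real) gchoose r)
        *\<^sub>R (coeff_psdo P i * (dx ^^ r) (coeff_psdo (1 :: 'a psdo) (k - i + int r))))"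
    have "t a = (if a = (k, 0) then coeff_psdo P k else 0)" for a
      by (cases a; cases "snd a = 0") (auto simp: t_def one_psdo.rep_eq dx_pow_1 if_distrib)
    then have "t = (\<lambda>a. if a = (k, 0) then coeff_psdo P k else 0)" by blast
    then show "coeff_psdo (P * 1) k = coeff_psdo P k"
      unfolding times_psdo.rep_eq psdo_mult_coeff_def t_def[symmetric] by simp
  qed
  show "(0 :: 'a psdo) \<noteq> 1"
  proof
    assume "(0 :: 'a psdo) = 1"
    then have "coeff_psdo (0 :: 'a psdo) 0 = coeff_psdo 1 0" by simp
    then show False by (simp add: zero_psdo.rep_eq one_psdo.rep_eq)
  qed
qed

end

lift_definition psdo_del :: "int \<Rightarrow> 'a::comm_ring_1 psdo" is "\<lambda>j i. if i = j then 1 else 0"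
proof -
  fix j :: int
  show "\<exists>N. \<forall>i>N. (if i = j then 1 else 0 :: 'a) = 0" by (rule exI[of _ j]) simp
qed

lift_definition psdo_fun :: "'a::comm_ring_1 \<Rightarrow> 'a psdo" is "\<lambda>a i. if i = 0 then a else 0"
  by (rule exI[of _ 0]) simp

lift_definition psdo_minus :: "'a::comm_ring_1 psdo \<Rightarrow> 'a psdo" is "\<lambda>p i. if i < 0 then p i else 0"
  by auto

lift_definition psdo_dx :: "'a::differential_algebra psdo \<Rightarrow> 'a psdo" is "\<lambda>p i. dx (p i)"
  by (metis dx_0)

text \<open>
  \<open>(-\<partial>)\<^sup>i p\<^sub>i = \<Sum>\<^sub>r (-1)\<^sup>i binom(i, r) p\<^sub>i\<^sup>(\<^sup>r\<^sup>) \<partial>\<^sup>i\<^sup>-\<^sup>r\<close>; the coefficient at \<open>\<partial>\<^sup>k\<close> collects \<open>i = k + r\<close>.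
\<close>

lift_definition psdo_adjoint :: "'a::differential_algebra psdo \<Rightarrow> 'a psdo" is
  "\<lambda>p k. Sum_any (\<lambda>r::nat.
      ((-1) powi (k + int r) * (of_int (k + int r) gchoose r) :: real) *\<^sub>R (dx ^^ r) (p (k + int r)))"
proof -
  fix p :: "int \<Rightarrow> 'a"
  assume "\<exists>N. \<forall>i>N. p i = 0"
  then obtain N where N: "\<forall>i>N. p i = 0" by blast
  have "Sum_any (\<lambda>r::nat.
      ((-1) powi (k + int r) * (of_int (k + int r) gchoose r) :: real) *\<^sub>R (dx ^^ r) (p (k + int r))) = 0"
    if "k > N" for k
  proof -
    have "p (k + int r) = 0" for r using N that by simp
    then show ?thesis by simp
  qed
  then show "\<exists>N. \<forall>k>N. Sum_any (\<lambda>r::nat.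
      ((-1) powi (k + int r) * (of_int (k + int r) gchoose r) :: real) *\<^sub>R (dx ^^ r) (p (k + int r))) = 0"
    by blast
qed

section \<open>Formal power series in commuting, central indeterminates\<close>

text \<open>The coefficient ring need not be commutative.\<close>

typedef ('v, 'a) mfps = "UNIV :: (('v \<Rightarrow>\<^sub>0 nat) \<Rightarrow> 'a) set"
  morphisms coeff_mfps Abs_mfps ..

setup_lifting type_definition_mfps

lemma mfps_eqI: "(\<And>m. coeff_mfps P m = coeff_mfps Q m) \<Longrightarrow> P = Q"
  by (simp add: coeff_mfps_inject[symmetric] fun_eq_iff)

lemma finite_monomial_factors: "finite {a :: 'v \<Rightarrow>\<^sub>0 nat. \<exists>b. a + b = m}"
proof (rule finite_subset)
  let ?K = "Poly_Mapping.keys m"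
  let ?n = "Max (insert 0 (Poly_Mapping.lookup m ` ?K))"
  let ?F = "{f. \<forall>v. (v \<in> ?K \<longrightarrow> f v \<in> {..?n}) \<and> (v \<notin> ?K \<longrightarrow> f v = 0)}"
  have "finite ?F"
    by (rule finite_set_of_finite_funs) auto
  then show "finite (Poly_Mapping.lookup -` ?F)"
    by (rule finite_vimageI) (simp add: inj_def Poly_Mapping.lookup_inject)
  show "{a. \<exists>b. a + b = m} \<subseteq> Poly_Mapping.lookup -` ?F"
  proof
    fix a assume "a \<in> {a. \<exists>b. a + b = m}"
    then have le: "Poly_Mapping.lookup a v \<le> Poly_Mapping.lookup m v" for v
      by (auto simp: lookup_add)
    have "Poly_Mapping.lookup a v \<le> ?n" if "v \<in> ?K" for v
      by (rule order_trans[OF le]) (use that in \<open>auto intro!: Max_ge\<close>)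
    moreover have "Poly_Mapping.lookup a v = 0" if "v \<notin> ?K" for v
      using le[of v] that by (simp add: in_keys_iff)
    ultimately show "a \<in> Poly_Mapping.lookup -` ?F"
      unfolding vimage_def mem_Collect_eq atMost_iff by blast
  qed
qed

lemma finite_monomial_pairs: "finite {(a :: 'v \<Rightarrow>\<^sub>0 nat, b). a + b = m}"
proof -
  have "{(a, b). a + b = m} = (\<lambda>a. (a, m - a)) ` {a. \<exists>b. a + b = m}"
    by auto
  then show ?thesis by (simp add: finite_monomial_factors)
qed

instantiation mfps :: (type, ring_1) ring_1
begin

lift_definition zero_mfps :: "('a, 'b) mfps" is "\<lambda>_. 0" .
lift_definition one_mfps :: "('a, 'b) mfps" is "\<lambda>m. if m = 0 then 1 else 0" .
lift_definition plus_mfps :: "('a, 'b) mfps \<Rightarrow> ('a, 'b) mfps \<Rightarrow> ('a, 'b) mfps" is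
  "\<lambda>f g m. f m + g m" .
lift_definition uminus_mfps :: "('a, 'b) mfps \<Rightarrow> ('a, 'b) mfps" is "\<lambda>f m. - f m" .
lift_definition minus_mfps :: "('a, 'b) mfps \<Rightarrow> ('a, 'b) mfps \<Rightarrow> ('a, 'b) mfps" is
  "\<lambda>f g m. f m - g m" .
lift_definition times_mfps :: "('a, 'b) mfps \<Rightarrow> ('a, 'b) mfps \<Rightarrow> ('a, 'b) mfps" is
  "\<lambda>f g m. \<Sum>(a, b) \<in> {(a, b). a + b = m}. f a * g b" .

instance
proof
  fix P Q R :: "('a, 'b) mfps"
  let ?D = "\<lambda>m. {(a :: 'a \<Rightarrow>\<^sub>0 nat, b). a + b = m}"
  let ?p = "coeff_mfps P" and ?q = "coeff_mfps Q" and ?r = "coeff_mfps R"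
  show "P + Q + R = P + (Q + R)" "P + Q = Q + P" "0 + P = P" "- P + P = 0" "P - Q = P + - Q"
    by (rule mfps_eqI; simp add: plus_mfps.rep_eq zero_mfps.rep_eq uminus_mfps.rep_eq
        minus_mfps.rep_eq add.assoc add.commute)+
  show "(P + Q) * R = P * R + Q * R" "P * (Q + R) = P * Q + P * R"
    by (rule mfps_eqI; simp add: plus_mfps.rep_eq times_mfps.rep_eq algebra_simps
        sum.distrib case_prod_beta)+
  show "P * Q * R = P * (Q * R)"
  proof (rule mfps_eqI)
    fix m
    have "coeff_mfps (P * Q * R) m = (\<Sum>x\<in>?D m. \<Sum>y\<in>?D (fst x). ?p (fst y) * ?q (snd y) * ?r (snd x))"
      by (simp add: times_mfps.rep_eq sum_distrib_right case_prod_beta)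
    also have "\<dots> = (\<Sum>(x, y)\<in>(SIGMA x:?D m. ?D (fst x)). ?p (fst y) * ?q (snd y) * ?r (snd x))"
      by (rule sum.Sigma) (auto simp: finite_monomial_pairs)
    also have "\<dots> = (\<Sum>(x, y)\<in>(SIGMA x:?D m. ?D (snd x)). ?p (fst x) * (?q (fst y) * ?r (snd y)))"
      by (rule sum.reindex_bij_witness[where
            i = "\<lambda>((a, d), (b, c)). ((a + b, c), (a, b))" and
            j = "\<lambda>((d, c), (a, b)). ((a, b + c), (b, c))"]) (auto simp: add.assoc mult.assoc)
    also have "\<dots> = (\<Sum>x\<in>?D m. \<Sum>y\<in>?D (snd x). ?p (fst x) * (?q (fst y) * ?r (snd y)))"
      by (rule sum.Sigma[symmetric]) (auto simp: finite_monomial_pairs)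
    also have "\<dots> = coeff_mfps (P * (Q * R)) m"
      by (simp add: times_mfps.rep_eq sum_distrib_left case_prod_beta)
    finally show "coeff_mfps (P * Q * R) m = coeff_mfps (P * (Q * R)) m" .
  qed
  show "1 * P = P"
  proof (rule mfps_eqI)
    fix m
    have "coeff_mfps (1 * P) m = (\<Sum>(a, b)\<in>{(0, m)}. coeff_mfps 1 a * ?p b)"
      unfolding times_mfps.rep_eq
      by (rule sum.mono_neutral_right) (auto simp: finite_monomial_pairs one_mfps.rep_eq split: if_splits)
    then show "coeff_mfps (1 * P) m = ?p m" by (simp add: one_mfps.rep_eq)
  qed
  show "P * 1 = P"
  proof (rule mfps_eqI)
    fix m
    have "coeff_mfps (P * 1) m = (\<Sum>(a, b)\<in>{(m, 0)}. ?p a * coeff_mfps 1 b)"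
      unfolding times_mfps.rep_eq
      by (rule sum.mono_neutral_right) (auto simp: finite_monomial_pairs one_mfps.rep_eq split: if_splits)
    then show "coeff_mfps (P * 1) m = ?p m" by (simp add: one_mfps.rep_eq)
  qed
  show "(0 :: ('a, 'b) mfps) \<noteq> 1"
  proof
    assume "(0 :: ('a, 'b) mfps) = 1"
    then have "coeff_mfps (0 :: ('a, 'b) mfps) 0 = coeff_mfps 1 0" by simp
    then show False by (simp add: zero_mfps.rep_eq one_mfps.rep_eq)
  qed
qed

end

definition mfps_monom :: "('v \<Rightarrow>\<^sub>0 nat) \<Rightarrow> 'a::zero \<Rightarrow> ('v, 'a) mfps" where
  "mfps_monom m a = Abs_mfps (\<lambda>m'. if m' = m then a else 0)"

abbreviation mfps_const :: "'a::zero \<Rightarrow> ('v, 'a) mfps" where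
  "mfps_const \<equiv> mfps_monom 0"

abbreviation mfps_var :: "'v \<Rightarrow> ('v, 'a::ring_1) mfps" where
  "mfps_var v \<equiv> mfps_monom (Poly_Mapping.single v 1) 1"

definition mfps_map :: "('a \<Rightarrow> 'b) \<Rightarrow> ('v, 'a) mfps \<Rightarrow> ('v, 'b) mfps" where
  "mfps_map h P = Abs_mfps (\<lambda>m. h (coeff_mfps P m))"

definition mfps_pderiv :: "'v \<Rightarrow> ('v, 'a::ring_1) mfps \<Rightarrow> ('v, 'a) mfps" where
  "mfps_pderiv v P = Abs_mfps (\<lambda>m.
     of_nat (Poly_Mapping.lookup m v + 1) * coeff_mfps P (m + Poly_Mapping.single v 1))"

text \<open>Setting the indeterminate \<open>v\<close> to zero.\<close>

definition mfps_at0 :: "'v \<Rightarrow> ('v, 'a::zero) mfps \<Rightarrow> ('v, 'a) mfps" where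
  "mfps_at0 v P = Abs_mfps (\<lambda>m. if Poly_Mapping.lookup m v = 0 then coeff_mfps P m else 0)"

text \<open>
  Sum of a family that is locally finite, i.e. in which every monomial receives a nonzero
  contribution from only finitely many members. (At a monomial where this fails the
  coefficient defaults to \<open>0\<close>; this does not happen for the families below.)
\<close>

definition mfps_sum :: "('i \<Rightarrow> ('v, 'a::comm_monoid_add) mfps) \<Rightarrow> ('v, 'a) mfps" where
  "mfps_sum F = Abs_mfps (\<lambda>m. Sum_any (\<lambda>i. coeff_mfps (F i) m))"

section \<open>The BKP hierarchy\<close>

text \<open>
  The coefficients of the operators are formal power series in \<open>t\<^sub>3, t\<^sub>5, \<dots>\<close> over an arbitrary
  differential algebra of functions of \<open>x = t\<^sub>1\<close>. As \<open>\<partial>\<close> does not act on \<open>t\<^sub>3, t\<^sub>5, \<dots>\<close>, a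
  pseudo-differential operator over these coefficients is a power series in \<open>t\<^sub>3, t\<^sub>5, \<dots>\<close>
  whose coefficients are pseudo-differential operators in \<open>x\<close>. Such a series is allowed to
  contain arbitrarily high powers of \<open>\<partial>\<close>, as long as this does not happen at a single monomial
  in \<open>t\<^sub>3, t\<^sub>5, \<dots>\<close>; this is needed for the infinite sum \<open>\<Gamma>\<close>.

  There are three further indeterminates. \<open>LogQ\<close> stands for \<open>log q\<close>. \<open>ExpM\<close> keeps track of
  the powers of \<open>M\<close> in the formal series \<open>e\<^sup>m\<^sup>M = \<Sum>\<^sub>p m\<^sup>p M\<^sup>p / p!\<close>, so \<open>D\<close> is a formal
  series in \<open>ExpM\<close> and \<open>LogQ\<close>, without any convergence requirement. \<open>Eps\<close> is used to
  differentiate functionals of \<open>\<Phi>\<close> along a flow.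
\<close>

datatype indet = Time nat | ExpM | LogQ | Eps

type_synonym 'a bkp_op = "(indet, 'a psdo) mfps"

definition depends_on_times :: "'a::differential_algebra bkp_op \<Rightarrow> bool" where
  "depends_on_times P \<longleftrightarrow>
    (\<forall>m. coeff_mfps P m \<noteq> 0 \<longrightarrow> Poly_Mapping.keys m \<subseteq> {Time i | i. odd i \<and> i \<ge> 3})"

definition del :: "int \<Rightarrow> 'a::differential_algebra bkp_op" where
  "del j = mfps_const (psdo_del j)"

definition op_minus :: "'a::differential_algebra bkp_op \<Rightarrow> 'a bkp_op" where
  "op_minus = mfps_map psdo_minus"

definition op_plus :: "'a::differential_algebra bkp_op \<Rightarrow> 'a bkp_op" where
  "op_plus P = P - op_minus P"

definition op_adjoint :: "'a::differential_algebra bkp_op \<Rightarrow> 'a bkp_op" where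
  "op_adjoint = mfps_map psdo_adjoint"

definition op_inv :: "'a::differential_algebra bkp_op \<Rightarrow> 'a bkp_op" where
  "op_inv P = (THE Q. P * Q = 1 \<and> Q * P = 1)"

definition op_powi :: "'a::differential_algebra bkp_op \<Rightarrow> int \<Rightarrow> 'a bkp_op" where
  "op_powi P j = (if j \<ge> 0 then P ^ nat j else op_inv P ^ nat (- j))"

text \<open>\<open>\<partial>/\<partial>t\<^sub>n\<close> acting on the coefficients of an operator.\<close>

definition dt :: "nat \<Rightarrow> 'a::differential_algebra bkp_op \<Rightarrow> 'a bkp_op" where
  "dt n = (if n = 1 then mfps_map psdo_dx else mfps_pderiv (Time n))"

definition bkp_lax :: "'a::differential_algebra bkp_op \<Rightarrow> bool" where
  "bkp_lax L \<longleftrightarrow>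
    depends_on_times L \<and>
    op_minus (L - del 1) = L - del 1 \<and>
    op_adjoint L = - (del 1 * L * del (-1)) \<and>
    (\<forall>k. odd k \<longrightarrow> dt k L = op_plus (L ^ k) * L - L * op_plus (L ^ k))"

definition bkp_dressing :: "'a::differential_algebra bkp_op \<Rightarrow> 'a bkp_op \<Rightarrow> bool" where
  "bkp_dressing L \<Phi> \<longleftrightarrow>
    depends_on_times \<Phi> \<and>
    op_minus (\<Phi> - 1) = \<Phi> - 1 \<and>
    L = \<Phi> * del 1 * op_inv \<Phi> \<and>
    op_adjoint \<Phi> = del 1 * op_inv \<Phi> * del (-1) \<and>
    (\<forall>n. odd n \<longrightarrow> dt n \<Phi> = - (op_minus (L ^ n)) * \<Phi>)"

definition lax_op :: "'a::differential_algebra bkp_op \<Rightarrow> 'a bkp_op" where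
  "lax_op \<Phi> = \<Phi> * del 1 * op_inv \<Phi>"

definition time :: "'a::differential_algebra \<Rightarrow> nat \<Rightarrow> 'a bkp_op" where
  "time x i = (if i = 1 then mfps_const (psdo_fun x) else mfps_var (Time i))"

definition Gamma_op :: "'a::differential_algebra \<Rightarrow> 'a bkp_op" where
  "Gamma_op x = mfps_sum (\<lambda>i. if odd i then of_nat i * time x i * del (int i - 1) else 0)"

definition orlov_shulman :: "'a::differential_algebra \<Rightarrow> 'a bkp_op \<Rightarrow> 'a bkp_op" where
  "orlov_shulman x \<Phi> = \<Phi> * Gamma_op x * op_inv \<Phi>"

definition B_op :: "'a::differential_algebra \<Rightarrow> nat \<Rightarrow> nat \<Rightarrow> 'a bkp_op \<Rightarrow> 'a bkp_op" where
  "B_op x m n \<Phi> =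
    (let L = lax_op \<Phi>; M = orlov_shulman x \<Phi>
     in M ^ m * L ^ n - (-1) ^ n * op_powi L (int n - 1) * M ^ m * L)"

definition D_op :: "'a::differential_algebra \<Rightarrow> nat \<Rightarrow> nat \<Rightarrow> 'a bkp_op \<Rightarrow> 'a bkp_op" where
  "D_op x m n \<Phi> = mfps_sum (\<lambda>(p, s).
     mfps_monom (Poly_Mapping.single ExpM p + Poly_Mapping.single LogQ s)
       (psdo_fun (of_real (real m ^ p * real n ^ s / (fact p * fact s)))) * B_op x p s \<Phi>)"

text \<open>
  A flow \<open>\<partial>\<^sub>\<tau>\<Phi> = V(\<Phi>)\<close> is given by its right-hand side \<open>V\<close>.
\<close>

definition bkp_flow :: "nat \<Rightarrow> 'a::differential_algebra bkp_op \<Rightarrow> 'a bkp_op" where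
  "bkp_flow n \<Phi> = - (op_minus (lax_op \<Phi> ^ n)) * \<Phi>"

definition additional_flow ::
    "'a::differential_algebra \<Rightarrow> nat \<Rightarrow> nat \<Rightarrow> 'a bkp_op \<Rightarrow> 'a bkp_op" where
  "additional_flow x m n \<Phi> = - (op_minus (D_op x m n \<Phi>)) * \<Phi>"

text \<open>
  The derivative of a functional \<open>F(\<Phi>)\<close> along the flow \<open>\<partial>\<^sub>\<tau>\<Phi> = V(\<Phi>)\<close>:
  \<open>\<partial>\<^sub>\<tau>(F(\<Phi>)) = d/d\<epsilon> F(\<Phi> + \<epsilon> V(\<Phi>))\<close> at \<open>\<epsilon> = 0\<close>. Here \<open>t\<close> and \<open>x\<close>, which occur
  explicitly in \<open>\<Gamma>\<close>, are kept fixed.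

  For a solution \<open>\<Phi>\<close> of the hierarchy, \<open>\<partial>\<Phi>/\<partial>t\<^sub>n = bkp_flow n \<Phi>\<close>. Applying the additional flow to this,
  \<open>\<partial>\<^bsub>t*\<^esub> (\<partial>\<Phi>/\<partial>t\<^sub>n)\<close> is \<open>flow_derivative (additional_flow x l k) (bkp_flow n) \<Phi>\<close>. In the other order,
  \<open>\<partial>/\<partial>t\<^sub>n (\<partial>\<^bsub>t*\<^esub> \<Phi>)\<close> is \<open>dt n (additional_flow x l k \<Phi>)\<close>, where \<open>dt n\<close> sees the dependence of \<open>\<Phi>\<close> on
  \<open>t\<^sub>n\<close> as well as the explicit one.
\<close>

definition flow_derivative ::
    "('a::differential_algebra bkp_op \<Rightarrow> 'a bkp_op) \<Rightarrow> ('a bkp_op \<Rightarrow> 'a bkp_op) \<Rightarrow> 'a bkp_op \<Rightarrow> 'a bkp_op" where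
  "flow_derivative V F \<Phi> = mfps_at0 Eps (mfps_pderiv Eps (F (\<Phi> + mfps_var Eps * V \<Phi>)))"

end

theory Submission
  imports Defs
begin

text \<open>
  Write \<open>A = L\<^sup>n\<close> and \<open>E = D\<^sub>-\<close>. Dressing \<open>\<partial>\<Gamma>/\<partial>t\<^sub>n = [\<partial>\<^sup>n, \<Gamma>]\<close> gives \<open>\<partial>M/\<partial>t\<^sub>n = [A\<^sub>+, M]\<close>, and
  likewise \<open>\<partial>L/\<partial>t\<^sub>n = [A\<^sub>+, L]\<close>; since \<open>\<partial>/\<partial>t\<^sub>n\<close> is a derivation, \<open>\<partial>D/\<partial>t\<^sub>n = [A\<^sub>+, D]\<close>. Along the
  additional flow, \<open>A\<close> changes by \<open>[-E, A]\<close>. The two mixed derivatives of \<open>\<Phi>\<close> are therefore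
  \<open>([E, A]\<^sub>- + A\<^sub>- E) \<Phi>\<close> and \<open>([D, A\<^sub>+]\<^sub>- + E A\<^sub>-) \<Phi>\<close>. Both equal \<open>([E, A\<^sub>+]\<^sub>- + E A\<^sub>-) \<Phi>\<close>, because
  \<open>[D\<^sub>+, A\<^sub>+]\<^sub>- = 0\<close> and \<open>[E, A\<^sub>-]\<^sub>- = [E, A\<^sub>-]\<close>.

  Both derivatives are derivations up to a ring endomorphism (the identity, or setting \<open>\<epsilon> = 0\<close>), and
  the operators on which such a derivation is a commutator with a fixed operator are closed under
  sums, products and inverses.
\<close>

section \<open>Derivations twisted by an endomorphism\<close>

text \<open>Axioms for differences suffice: zero, negatives and sums reduce to them.\<close>

locale twisted_derivation =
  fixes hom der :: "'r::ring_1 \<Rightarrow> 'r"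
  assumes hom_1: "hom 1 = 1"
    and hom_diff: "hom (P - Q) = hom P - hom Q"
    and hom_mult: "hom (P * Q) = hom P * hom Q"
    and der_diff: "der (P - Q) = der P - der Q"
    and der_mult: "der (P * Q) = der P * hom Q + hom P * der Q"
begin

definition inner :: "'r \<Rightarrow> 'r \<Rightarrow> bool" where
  "inner A P \<longleftrightarrow> der P = A * hom P - hom P * A"

lemma der_1: "der 1 = 0"
  using der_mult[of 1 1] by (simp add: hom_1)

lemma der_0: "der 0 = 0"
  using der_diff[of 0 0] by simp

lemma hom_0: "hom 0 = 0"
  using hom_diff[of 0 0] by simp

lemma inner_1: "inner A 1"
  by (simp add: inner_def der_1 hom_1)

lemma inner_diff: "inner A P \<Longrightarrow> inner A Q \<Longrightarrow> inner A (P - Q)"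
  by (simp add: inner_def der_diff hom_diff algebra_simps)

text \<open>In the Leibniz expansion the two mixed terms \<open>hom P * A * hom Q\<close>
  cancel.\<close>

lemma inner_mult:
  assumes "inner A P" "inner A Q"
  shows "inner A (P * Q)"
  using assms[unfolded inner_def]
  by (simp add: inner_def der_mult hom_mult left_diff_distrib right_diff_distrib mult.assoc)

lemma inner_power: "inner A P \<Longrightarrow> inner A (P ^ n)"
  by (induction n) (auto intro: inner_1 inner_mult)

text \<open>Differentiating \<open>P * Q = 1\<close> and multiplying by \<open>hom Q\<close> on the
  left isolates \<open>der Q\<close>.\<close>

lemma der_inverse:
  assumes "P * Q = 1" "Q * P = 1"
  shows "der Q = - (hom Q * der P * hom Q)"
proof -
  have "hom Q * (der P * hom Q + hom P * der Q) = 0"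
    using der_mult[of P Q] by (simp add: assms der_1)
  moreover have "hom Q * (hom P * der Q) = der Q"
    using hom_mult[of Q P] by (simp add: assms hom_1 flip: mult.assoc)
  ultimately show ?thesis
    by (simp add: distrib_left mult.assoc eq_neg_iff_add_eq_0 add.commute)
qed

lemma inner_inverse:
  assumes "P * Q = 1" "Q * P = 1" "inner A P"
  shows "inner A Q"
proof -
  have "hom Q * hom P = 1" "hom P * hom Q = 1"
    using hom_mult[of Q P] hom_mult[of P Q] by (simp_all add: assms hom_1)
  then have "hom Q * (hom P * Z) = Z" "hom P * (hom Q * Z) = Z" for Z
    by (simp_all flip: mult.assoc)
  then show ?thesis
    using \<open>hom P * hom Q = 1\<close>
    by (simp add: inner_def der_inverse[OF assms(1,2)] assms(3)[unfolded inner_def] algebra_simps)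
qed

text \<open>Dressing: conjugation carries the commutator with \<open>D\<close> to one with the
  conjugate of \<open>D\<close>, and the motion of \<open>P\<close> and its inverse contributes
  \<open>- N\<close>. The time flow uses \<open>D\<close> = \<partial>^n and \<open>N\<close> =
  (L^n)_-; the additional flow uses \<open>D = 0\<close> and its own negative part as
  \<open>N\<close>.\<close>

lemma inner_conj:
  assumes PQ: "P * Q = 1" "Q * P = 1"
    and P: "der P = - N * hom P"
    and X: "der X = D * hom X - hom X * D"
  shows "inner (hom P * D * hom Q - N) (P * X * Q)"
proof -
  have hPQ: "hom Q * hom P = 1"
    using hom_mult[of Q P] by (simp add: PQ hom_1)
  have hPQ': "hom P * hom Q = 1"
    using hom_mult[of P Q] by (simp add: PQ hom_1)
  have cancel: "hom Q * (hom P * Z) = Z" for Z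
    using hPQ by (simp flip: mult.assoc)
  have Q: "der Q = hom Q * N"
    using hPQ' by (simp add: der_inverse[OF PQ] P mult.assoc)
  show ?thesis
    by (simp add: inner_def der_mult hom_mult P X Q cancel algebra_simps)
qed

end

section \<open>Formal power series\<close>

lemma coeff_Abs_mfps [simp]: "coeff_mfps (Abs_mfps f) m = f m"
  by (simp add: Abs_mfps_inverse)

lemma coeff_mfps_0 [simp]: "coeff_mfps 0 m = 0"
  by (simp add: zero_mfps.rep_eq)

lemma coeff_mfps_1: "coeff_mfps 1 m = (if m = 0 then 1 else 0)"
  by (simp add: one_mfps.rep_eq)

lemma coeff_mfps_add [simp]: "coeff_mfps (P + Q) m = coeff_mfps P m + coeff_mfps Q m"
  by (simp add: plus_mfps.rep_eq)

lemma coeff_mfps_diff [simp]: "coeff_mfps (P - Q) m = coeff_mfps P m - coeff_mfps Q m"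
  by (simp add: minus_mfps.rep_eq)

lemma coeff_mfps_uminus [simp]: "coeff_mfps (- P) m = - coeff_mfps P m"
  by (simp add: uminus_mfps.rep_eq)

lemma coeff_mfps_mult:
  "coeff_mfps (P * Q) m = (\<Sum>(a, b) | a + b = m. coeff_mfps P a * coeff_mfps Q b)"
  by (simp add: times_mfps.rep_eq)

lemma coeff_mfps_sum: "coeff_mfps (sum F A) m = (\<Sum>i\<in>A. coeff_mfps (F i) m)"
  by (induction A rule: infinite_finite_induct) auto

lemma coeff_mfps_map [simp]: "coeff_mfps (mfps_map h P) m = h (coeff_mfps P m)"
  by (simp add: mfps_map_def)

lemma coeff_mfps_monom: "coeff_mfps (mfps_monom k a) m = (if m = k then a else 0)"
  by (simp add: mfps_monom_def)

lemma coeff_mfps_at0: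
  "coeff_mfps (mfps_at0 v P) m = (if Poly_Mapping.lookup m v = 0 then coeff_mfps P m else 0)"
  by (simp add: mfps_at0_def)

lemma coeff_mfps_pderiv:
  "coeff_mfps (mfps_pderiv v P) m
    = of_nat (Poly_Mapping.lookup m v + 1) * coeff_mfps P (m + Poly_Mapping.single v 1)"
  by (simp add: mfps_pderiv_def)

text \<open>Only the pair \<open>(k, m - k)\<close> can contribute. Subtraction of exponents is
  truncated, so the existential condition tests divisibility of \<open>m\<close> by
  \<open>k\<close>.\<close>

lemma coeff_mfps_mult_monom_left:
  "coeff_mfps (mfps_monom k c * P) m = (if \<exists>b. m = k + b then c * coeff_mfps P (m - k) else 0)"
proof -
  have "coeff_mfps (mfps_monom k c * P) m
      = (\<Sum>x\<in>{(a, b). a + b = m}. if x = (k, m - k) then c * coeff_mfps P (m - k) else 0)"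
    unfolding coeff_mfps_mult by (rule sum.cong) (auto simp: coeff_mfps_monom split: if_splits)
  also have "\<dots> = (if k + (m - k) = m then c * coeff_mfps P (m - k) else 0)"
    unfolding sum.delta[OF finite_monomial_pairs] by simp
  finally show ?thesis by (metis add_diff_cancel_left')
qed

lemma coeff_mfps_mult_monom_right:
  "coeff_mfps (P * mfps_monom k c) m = (if \<exists>b. m = k + b then coeff_mfps P (m - k) * c else 0)"
proof -
  have "coeff_mfps (P * mfps_monom k c) m
      = (\<Sum>x\<in>{(a, b). a + b = m}. if x = (m - k, k) then coeff_mfps P (m - k) * c else 0)"
    unfolding coeff_mfps_mult by (rule sum.cong) (auto simp: coeff_mfps_monom split: if_splits)
  also have "\<dots> = (if (m - k) + k = m then coeff_mfps P (m - k) * c else 0)"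
    unfolding sum.delta[OF finite_monomial_pairs] by simp
  finally show ?thesis by (metis add.commute add_diff_cancel_left')
qed

lemma mfps_monom_0_1: "mfps_monom 0 1 = 1"
  by (rule mfps_eqI) (simp add: coeff_mfps_monom coeff_mfps_1)

lemma mfps_monom_mult_const: "mfps_monom k a * mfps_const b = mfps_monom k (a * b)"
  by (rule mfps_eqI) (auto simp: coeff_mfps_mult_monom_right coeff_mfps_monom)

lemma of_nat_mult_mfps_monom: "of_nat i * mfps_monom k a = mfps_monom k (of_nat i * a)"
  by (rule mfps_eqI, induction i) (auto simp: coeff_mfps_monom distrib_right)

section \<open>Setting an indeterminate to zero, partial derivatives, infinite sums\<close>

lemma mfps_at0_1: "mfps_at0 v 1 = 1"
  by (rule mfps_eqI) (auto simp: coeff_mfps_at0 coeff_mfps_1)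

lemma mfps_at0_add: "mfps_at0 v (P + Q) = mfps_at0 v P + mfps_at0 v (Q :: ('v, 'a::ring_1) mfps)"
  by (rule mfps_eqI) (auto simp: coeff_mfps_at0)

lemma mfps_at0_uminus: "mfps_at0 v (- P) = - mfps_at0 v (P :: ('v, 'a::ring_1) mfps)"
  by (rule mfps_eqI) (auto simp: coeff_mfps_at0)

lemma mfps_at0_diff: "mfps_at0 v (P - Q) = mfps_at0 v P - mfps_at0 v (Q :: ('v, 'a::ring_1) mfps)"
  by (rule mfps_eqI) (auto simp: coeff_mfps_at0)

lemma mfps_at0_mult: "mfps_at0 v (P * Q) = mfps_at0 v P * mfps_at0 v (Q :: ('v, 'a::ring_1) mfps)"
proof (rule mfps_eqI)
  fix m
  show "coeff_mfps (mfps_at0 v (P * Q)) m = coeff_mfps (mfps_at0 v P * mfps_at0 v Q) m"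
  proof (cases "Poly_Mapping.lookup m v = 0")
    case True
    then show ?thesis
      unfolding coeff_mfps_at0 coeff_mfps_mult by (auto simp: lookup_add intro!: sum.cong)
  next
    case False
    then show ?thesis
      unfolding coeff_mfps_at0 coeff_mfps_mult
      by (subst (2) sum.neutral) (auto simp: lookup_add)
  qed
qed

lemma mfps_at0_power: "mfps_at0 v (P ^ n) = mfps_at0 v (P :: ('v, 'a::ring_1) mfps) ^ n"
  by (induction n) (auto simp: mfps_at0_1 mfps_at0_mult)

lemma mfps_at0_monom: "Poly_Mapping.lookup k v = 0 \<Longrightarrow> mfps_at0 v (mfps_monom k a) = mfps_monom k a"
  by (rule mfps_eqI) (auto simp: coeff_mfps_at0 coeff_mfps_monom)

lemma mfps_at0_var: "mfps_at0 v (mfps_var v) = 0"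
  by (rule mfps_eqI) (auto simp: coeff_mfps_at0 coeff_mfps_monom)

lemma mfps_pderiv_add: "mfps_pderiv v (P + Q) = mfps_pderiv v P + mfps_pderiv v Q"
  by (rule mfps_eqI) (simp add: coeff_mfps_pderiv algebra_simps)

lemma mfps_pderiv_diff: "mfps_pderiv v (P - Q) = mfps_pderiv v P - mfps_pderiv v Q"
  by (rule mfps_eqI) (simp add: coeff_mfps_pderiv algebra_simps)

text \<open>When \<open>a + b = m + v\<close>, the exponent of \<open>v\<close> is the sum of its
  exponents in \<open>a\<close> and \<open>b\<close>; each summand produces one Leibniz
  term.\<close>

lemma mfps_pderiv_mult: "mfps_pderiv v (P * Q) = mfps_pderiv v P * Q + P * mfps_pderiv v Q"
proof (rule mfps_eqI)
  fix m
  let ?v = "Poly_Mapping.single v (1 :: nat)"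
  let ?l = "\<lambda>a. of_nat (Poly_Mapping.lookup a v)"
  let ?p = "coeff_mfps P" and ?q = "coeff_mfps Q"
  let ?D = "{(a, b). a + b = m + ?v}"
  \<comment> \<open>Pairs with exponent 0 carry the factor 0. The others are exactly the pairs of
    sum \<open>m\<close> with one component raised by \<open>v\<close>.\<close>
  have image_left: "{(a, b) \<in> ?D. Poly_Mapping.lookup a v \<noteq> 0}
      = (\<lambda>(a, b). (a + ?v, b)) ` {(a, b). a + b = m}" (is "?A = ?f ` ?M")
    and image_right: "{(a, b) \<in> ?D. Poly_Mapping.lookup b v \<noteq> 0}
      = (\<lambda>(a, b). (a, b + ?v)) ` {(a, b). a + b = m}" (is "?B = ?g ` ?M")
  proof -
    have split: "\<exists>a'. a = a' + ?v" if "Poly_Mapping.lookup a v \<noteq> 0" for a :: "_ \<Rightarrow>\<^sub>0 nat"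
      using that by (intro exI[of _ "a - ?v"] poly_mapping_eqI)
        (auto simp: lookup_add lookup_minus lookup_single when_def)
    show "?A = ?f ` ?M"
    proof (intro set_eqI iffI)
      fix y assume "y \<in> ?A"
      then obtain a b where ab: "y = (a, b)" "a + b = m + ?v" "Poly_Mapping.lookup a v \<noteq> 0"
        by auto
      with split obtain a' where "a = a' + ?v" by blast
      with ab have "y = ?f (a', b)" "(a' + b) + ?v = m + ?v" by (auto simp: ac_simps)
      then show "y \<in> ?f ` ?M" by (intro image_eqI[of _ _ "(a', b)"]) simp_all
    qed (auto simp: lookup_add ac_simps)
    show "?B = ?g ` ?M"
    proof (intro set_eqI iffI)
      fix y assume "y \<in> ?B"
      then obtain a b where ab: "y = (a, b)" "a + b = m + ?v" "Poly_Mapping.lookup b v \<noteq> 0"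
        by auto
      with split obtain b' where "b = b' + ?v" by blast
      with ab have "y = ?g (a, b')" "(a + b') + ?v = m + ?v" by (auto simp: ac_simps)
      then show "y \<in> ?g ` ?M" by (intro image_eqI[of _ _ "(a, b')"]) simp_all
    qed (auto simp: lookup_add ac_simps)
  qed
  have inj_left: "inj_on (\<lambda>(a, b). (a + ?v, b)) {(a, b). a + b = m}"
    and inj_right: "inj_on (\<lambda>(a, b). (a, b + ?v)) {(a, b). a + b = m}"
    by (auto simp: inj_on_def)
  have "coeff_mfps (mfps_pderiv v (P * Q)) m = (\<Sum>(a, b)\<in>?D. ?l (m + ?v) * (?p a * ?q b))"
    by (simp add: coeff_mfps_pderiv coeff_mfps_mult sum_distrib_left case_prod_beta lookup_add)
  also have "\<dots> = (\<Sum>(a, b)\<in>?D. ?l a * ?p a * ?q b + ?p a * (?l b * ?q b))"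
  proof (rule sum.cong[OF refl], clarify)
    fix a b :: "_ \<Rightarrow>\<^sub>0 nat" assume "a + b = m + ?v"
    then have "Poly_Mapping.lookup (m + ?v) v = Poly_Mapping.lookup a v + Poly_Mapping.lookup b v"
      by (metis lookup_add)
    then have "?l (m + ?v) = ?l a + (?l b :: 'b)"
      by simp
    \<comment> \<open>The coefficients need not commute, but integers are central.\<close>
    moreover have "?l b * ?p a = ?p a * ?l b"
      by (rule mult_of_nat_commute)
    ultimately show "?l (m + ?v) * (?p a * ?q b) = ?l a * ?p a * ?q b + ?p a * (?l b * ?q b)"
      by (simp add: distrib_right flip: mult.assoc)
  qed
  also have "\<dots> = (\<Sum>(a, b)\<in>?D. ?l a * ?p a * ?q b) + (\<Sum>(a, b)\<in>?D. ?p a * (?l b * ?q b))"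
    by (simp add: sum.distrib case_prod_beta)
  also have "(\<Sum>(a, b)\<in>?D. ?l a * ?p a * ?q b)
      = (\<Sum>(a, b)\<in>{(a, b) \<in> ?D. Poly_Mapping.lookup a v \<noteq> 0}. ?l a * ?p a * ?q b)"
    by (rule sum.mono_neutral_right) (auto simp: finite_monomial_pairs intro: ccontr)
  also have "\<dots> = coeff_mfps (mfps_pderiv v P * Q) m"
    unfolding coeff_mfps_mult coeff_mfps_pderiv image_left
    by (subst sum.reindex[OF inj_left]) (simp add: o_def case_prod_beta lookup_add)
  also have "(\<Sum>(a, b)\<in>?D. ?p a * (?l b * ?q b))
      = (\<Sum>(a, b)\<in>{(a, b) \<in> ?D. Poly_Mapping.lookup b v \<noteq> 0}. ?p a * (?l b * ?q b))"
    by (rule sum.mono_neutral_right) (auto simp: finite_monomial_pairs intro: ccontr)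
  also have "\<dots> = coeff_mfps (P * mfps_pderiv v Q) m"
    unfolding coeff_mfps_mult coeff_mfps_pderiv image_right
    by (subst sum.reindex[OF inj_right]) (simp add: o_def case_prod_beta lookup_add)
  finally show "coeff_mfps (mfps_pderiv v (P * Q)) m
      = coeff_mfps (mfps_pderiv v P * Q + P * mfps_pderiv v Q) m"
    by simp
qed

text \<open>The hypothesis is the working form of "\<open>v\<close> does not occur in
  \<open>P\<close>".\<close>

lemma mfps_pderiv_eq_0:
  assumes "mfps_at0 v P = P"
  shows "mfps_pderiv v P = 0"
proof (rule mfps_eqI)
  fix m
  have "coeff_mfps (mfps_at0 v P) (m + Poly_Mapping.single v 1) = 0"
    by (simp add: coeff_mfps_at0 lookup_add)
  then show "coeff_mfps (mfps_pderiv v P) m = coeff_mfps 0 m"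
    by (simp add: assms coeff_mfps_pderiv)
qed

lemma mfps_pderiv_var: "mfps_pderiv v (mfps_var v) = 1"
proof (rule mfps_eqI)
  fix m
  show "coeff_mfps (mfps_pderiv v (mfps_var v)) m = coeff_mfps (1 :: ('a, 'b) mfps) m"
    unfolding coeff_mfps_pderiv coeff_mfps_monom coeff_mfps_1 add_cancel_left_left by simp
qed

text \<open>\<open>finitary\<close> is continuity: a coefficient of \<open>T P\<close> sees only
  finitely many coefficients of \<open>P\<close>, so a finite partial sum can replace the series.
  The set \<open>J\<close> allows for the summands that \<open>T\<close> does not kill.\<close>

lemma additive_mfps_sum:
  fixes T :: "('v, 'a::ring_1) mfps \<Rightarrow> ('w, 'b::ring_1) mfps"
  assumes loc_fin: "\<And>m. finite {i. coeff_mfps (F i) m \<noteq> 0}"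
    and add: "\<And>P Q. T (P + Q) = T P + T Q"
    and finitary: "\<And>m. \<exists>S. finite S \<and> (\<forall>P. (\<forall>a\<in>S. coeff_mfps P a = 0) \<longrightarrow> coeff_mfps (T P) m = 0)"
    and J: "finite J" "\<And>i. i \<notin> J \<Longrightarrow> T (F i) = 0"
  shows "T (mfps_sum F) = (\<Sum>i\<in>J. T (F i))"
proof (rule mfps_eqI)
  fix m
  obtain S where S: "finite S" "\<forall>P. (\<forall>a\<in>S. coeff_mfps P a = 0) \<longrightarrow> coeff_mfps (T P) m = 0"
    using finitary[of m] by (elim exE conjE)
  \<comment> \<open>These indices include every summand visible on \<open>S\<close>, so the
    remainder \<open>R\<close> vanishes there.\<close>
  define I where "I = J \<union> (\<Union>a\<in>S. {i. coeff_mfps (F i) a \<noteq> 0})"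
  have finI: "finite I"
    using S(1) J(1) loc_fin by (auto simp: I_def)
  define R where "R = mfps_sum F - sum F I"
  have T0: "T 0 = 0"
    using add[of 0 0] by simp
  have "coeff_mfps R a = 0" if "a \<in> S" for a
  proof -
    have "coeff_mfps (mfps_sum F) a = (\<Sum>i\<in>I. coeff_mfps (F i) a)"
      unfolding mfps_sum_def coeff_Abs_mfps
      by (rule Sum_any.expand_superset[OF finI]) (use that in \<open>auto simp: I_def\<close>)
    then show ?thesis by (simp add: R_def coeff_mfps_sum)
  qed
  then have "coeff_mfps (T R) m = 0"
    using S(2) by simp
  moreover have "T (sum F I) = (\<Sum>i\<in>I. T (F i))"
    using finI by (rule finite_induct) (auto simp: add T0)
  moreover have "(\<Sum>i\<in>I. T (F i)) = (\<Sum>i\<in>J. T (F i))"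
    by (rule sum.mono_neutral_right) (use finI J in \<open>auto simp: I_def\<close>)
  moreover have "mfps_sum F = R + sum F I"
    by (simp add: R_def)
  ultimately show "coeff_mfps (T (mfps_sum F)) m = coeff_mfps (\<Sum>i\<in>J. T (F i)) m"
    by (simp only: add coeff_mfps_add add_0)
qed

lemma mfps_at0_sum:
  fixes F :: "'i \<Rightarrow> ('v, 'a::ring_1) mfps"
  assumes "\<And>m. finite {i. coeff_mfps (F i) m \<noteq> 0}" "\<And>i. mfps_at0 v (F i) = F i"
  shows "mfps_at0 v (mfps_sum F) = mfps_sum F"
proof -
  \<comment> \<open>The difference between \<open>mfps_at0 v\<close> and the identity kills every
    summand, hence \<open>J\<close> is empty.\<close>
  have "mfps_at0 v (mfps_sum F) - mfps_sum F = (\<Sum>i\<in>{}. mfps_at0 v (F i) - F i)"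
    using assms
    by (intro additive_mfps_sum[where T = "\<lambda>P. mfps_at0 v P - P"])
      (auto simp: mfps_at0_add coeff_mfps_at0 intro!: exI[of _ "{m}" for m])
  then show ?thesis by simp
qed

section \<open>Pseudo-differential operators\<close>

lemma coeff_psdo_0 [simp]: "coeff_psdo 0 i = 0"
  by (simp add: zero_psdo.rep_eq)

lemma coeff_psdo_add [simp]: "coeff_psdo (P + Q) i = coeff_psdo P i + coeff_psdo Q i"
  by (simp add: plus_psdo.rep_eq)

lemma coeff_psdo_uminus [simp]: "coeff_psdo (- P) i = - coeff_psdo P i"
  by (simp add: uminus_psdo.rep_eq)

lemma coeff_psdo_diff [simp]: "coeff_psdo (P - Q) i = coeff_psdo P i - coeff_psdo Q i"
  by (simp only: diff_conv_add_uminus coeff_psdo_add coeff_psdo_uminus)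

lemma coeff_psdo_sum: "coeff_psdo (sum F A) i = (\<Sum>j\<in>A. coeff_psdo (F j) i)"
  by (induction A rule: infinite_finite_induct) auto

lemma coeff_psdo_mult:
  "coeff_psdo (P * Q) k = Sum_any (\<lambda>(i, r). ((of_int i :: real) gchoose r)
     *\<^sub>R (coeff_psdo P i * (dx ^^ r) (coeff_psdo Q (k - i + int r))))"
  by (simp add: times_psdo.rep_eq psdo_mult_coeff_def)

lemma coeff_psdo_mult_eq_0:
  assumes "\<And>i. i > d \<Longrightarrow> coeff_psdo P i = 0" "\<And>i. i > e \<Longrightarrow> coeff_psdo Q i = 0" "k > d + e"
  shows "coeff_psdo (P * Q) k = 0"
  unfolding times_psdo.rep_eq by (rule psdo_mult_coeff_bound[OF assms])

lemma coeff_psdo_mult_del: "coeff_psdo (P * psdo_del j) k = coeff_psdo P (k - j)"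
proof -
  have "((of_int i :: real) gchoose r) *\<^sub>R
      (coeff_psdo P i * (dx ^^ r) (coeff_psdo (psdo_del j) (k - i + int r)))
    = (if (i, r) = (k - j, 0) then coeff_psdo P (k - j) else 0)" for i r
    by (auto simp: psdo_del.rep_eq dx_pow_1 if_distrib[of "dx ^^ r"])
  then show ?thesis
    by (simp add: coeff_psdo_mult del: prod.inject)
qed

lemma psdo_del_mult: "psdo_del i * psdo_del j = psdo_del (i + j)"
  by (rule psdo_eqI) (auto simp: coeff_psdo_mult_del psdo_del.rep_eq)

lemma psdo_del_0: "psdo_del 0 = 1"
  by (rule psdo_eqI) (simp add: psdo_del.rep_eq one_psdo.rep_eq)

lemma coeff_psdo_del_1_mult:
  "coeff_psdo (psdo_del 1 * P) k = coeff_psdo P (k - 1) + dx (coeff_psdo P k)"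
proof -
  let ?t = "\<lambda>(i, r). ((of_int i :: real) gchoose r) *\<^sub>R
      (coeff_psdo (psdo_del 1) i * (dx ^^ r) (coeff_psdo P (k - i + int r)))"
  \<comment> \<open>Since binom(1, r) vanishes for r \<ge> 2, only two terms of the product
    survive.\<close>
  have g: "((1 :: real) gchoose r) = 0" if "r \<noteq> 0" "r \<noteq> 1" for r
    using binomial_gbinomial[of 1 r, where 'a = real] that by (simp add: binomial_eq_0)
  have "?t (i, r) = 0" if "(i, r) \<notin> {(1, 0), (1, 1)}" for i r
    using that g by (cases "i = 1") (auto simp: psdo_del.rep_eq)
  then have "{a. ?t a \<noteq> 0} \<subseteq> {(1, 0), (1, 1)}"
    by (intro subsetI) (metis (mono_tags) mem_Collect_eq surj_pair)
  then have "coeff_psdo (psdo_del 1 * P) k = sum ?t {(1, 0), (1, 1)}"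
    unfolding coeff_psdo_mult by (intro Sum_any.expand_superset) auto
  then show ?thesis by (simp add: psdo_del.rep_eq)
qed

text \<open>Makes \<partial>/\<partial>x an inner derivation, so its Leibniz rule follows from
  associativity.\<close>

lemma psdo_dx_eq_commutator: "psdo_dx P = psdo_del 1 * P - P * psdo_del 1"
  by (rule psdo_eqI) (simp add: psdo_dx.rep_eq coeff_psdo_del_1_mult coeff_psdo_mult_del)

lemma dx_of_real: "dx (of_real c :: 'a::differential_algebra) = 0"
  by (simp add: of_real_def dx_scaleR)

lemma dx_of_nat: "dx (of_nat n :: 'a::differential_algebra) = 0"
  using dx_of_real[of "real n"] by (simp only: of_real_of_nat_eq)

lemma dx_pow_of_real: "(dx ^^ r) (of_real c :: 'a::differential_algebra) = (if r = 0 then of_real c else 0)"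
  by (simp add: of_real_def dx_pow_scaleR dx_pow_1)

text \<open>Real constants have zero derivative, which leaves only the term r = 0 on both sides.
  This makes the numerical factors in \<open>D_op\<close> central.\<close>

lemma psdo_fun_of_real_commute:
  "psdo_fun (of_real c) * P = P * psdo_fun (of_real c :: 'a::differential_algebra)"
proof (rule psdo_eqI)
  fix k
  have "((of_int i :: real) gchoose r) *\<^sub>R
      (coeff_psdo (psdo_fun (of_real c)) i * (dx ^^ r) (coeff_psdo P (k - i + int r)))
    = (if (i, r) = (0, 0) then of_real c * coeff_psdo P k else 0)" for i r
    by (cases r) (auto simp: psdo_fun.rep_eq)
  then have "coeff_psdo (psdo_fun (of_real c) * P) k = of_real c * coeff_psdo P k"
    by (simp add: coeff_psdo_mult del: prod.inject)
  moreover have "((of_int i :: real) gchoose r) *\<^sub>R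
      (coeff_psdo P i * (dx ^^ r) (coeff_psdo (psdo_fun (of_real c)) (k - i + int r)))
    = (if (i, r) = (k, 0) then of_real c * coeff_psdo P k else 0)" for i r
    by (auto simp: psdo_fun.rep_eq dx_pow_of_real if_distrib[of "dx ^^ r"])
  then have "coeff_psdo (P * psdo_fun (of_real c)) k = of_real c * coeff_psdo P k"
    by (simp add: coeff_psdo_mult del: prod.inject)
  ultimately show "coeff_psdo (psdo_fun (of_real c) * P) k = coeff_psdo (P * psdo_fun (of_real c)) k"
    by simp
qed

lemma coeff_psdo_minus: "coeff_psdo (psdo_minus P) i = (if i < 0 then coeff_psdo P i else 0)"
  by (simp add: psdo_minus.rep_eq)

text \<open>Differential operators compose without negative powers because \<open>binom(i, r) = 0\<close> for \<open>r > i \<ge> 0\<close>.\<close>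

lemma psdo_minus_mult_eq_0:
  assumes "psdo_minus P = 0" "psdo_minus Q = 0"
  shows "psdo_minus (P * Q) = 0"
proof (rule psdo_eqI)
  fix k
  have neg: "coeff_psdo R i = 0" if "psdo_minus R = 0" "i < 0" for R :: "'a psdo" and i
    using that coeff_psdo_minus[of R i] by simp
  have "((of_int i :: real) gchoose r) *\<^sub>R
      (coeff_psdo P i * (dx ^^ r) (coeff_psdo Q (k - i + int r))) = 0" if k: "k < 0" for i r
  proof -
    consider "i < 0" | "k - i + int r < 0" | "i \<ge> 0" "nat i < r"
      using k by linarith
    then show ?thesis
    proof cases
      case 3
      then have "(of_int i :: real) gchoose r = of_nat (nat i choose r)"
        by (simp add: binomial_gbinomial)
      with 3 show ?thesis by simp
    qed (auto simp: neg assms)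
  qed
  then have "(\<lambda>(i, r). ((of_int i :: real) gchoose r) *\<^sub>R
      (coeff_psdo P i * (dx ^^ r) (coeff_psdo Q (k - i + int r)))) = (\<lambda>_. 0)" if "k < 0"
    using that by (auto simp only: fun_eq_iff split: prod.split)
  then show "coeff_psdo (psdo_minus (P * Q)) k = coeff_psdo 0 k"
    by (simp add: coeff_psdo_minus coeff_psdo_mult)
qed

lemma psdo_minus_diff: "psdo_minus (P - Q) = psdo_minus P - psdo_minus Q"
  by (rule psdo_eqI) (simp add: coeff_psdo_minus)

lemma coeff_psdo_of_nat_mult: "coeff_psdo (of_nat n * P) i = of_nat n * coeff_psdo P i"
  by (induction n) (simp_all add: distrib_right)

section \<open>Operators depending on the times\<close>

lemma op_minus_diff: "op_minus (P - Q) = op_minus P - op_minus Q"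
  by (rule mfps_eqI) (simp add: op_minus_def psdo_minus_diff)

lemma op_minus_add: "op_minus (P + Q) = op_minus P + op_minus Q"
  by (rule mfps_eqI) (auto simp: op_minus_def coeff_psdo_minus intro: psdo_eqI)

lemma op_minus_idem: "op_minus (op_minus P) = op_minus P"
  by (rule mfps_eqI) (auto simp: op_minus_def coeff_psdo_minus intro: psdo_eqI)

lemma op_minus_op_plus: "op_minus (op_plus P) = 0"
  by (simp add: op_plus_def op_minus_diff op_minus_idem)

lemma op_minus_mult_eq_0:
  assumes "op_minus P = 0" "op_minus Q = 0"
  shows "op_minus (P * Q) = 0"
proof (rule mfps_eqI)
  fix m
  have 0: "psdo_minus (coeff_mfps R a) = 0" if "op_minus R = 0" for R :: "'a bkp_op" and a
    using arg_cong[OF that, of "\<lambda>R. coeff_mfps R a"] by (simp add: op_minus_def)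
  have "coeff_psdo (psdo_minus (coeff_mfps P a * coeff_mfps Q b)) i = 0" for a b i
    by (simp add: psdo_minus_mult_eq_0 0 assms)
  then have "i < 0 \<Longrightarrow> coeff_psdo (coeff_mfps P a * coeff_mfps Q b) i = 0" for a b i
    unfolding coeff_psdo_minus by meson
  then show "coeff_mfps (op_minus (P * Q)) m = coeff_mfps 0 m"
    by (intro psdo_eqI)
      (auto simp: op_minus_def coeff_psdo_minus coeff_mfps_mult coeff_psdo_sum case_prod_beta)
qed

text \<open>The bound is uniform over all monomials. \<open>Gamma_op\<close> has no such bound in
  general, but the dressing operator has, and this filtration is where its inverse
  converges.\<close>

definition order_le :: "int \<Rightarrow> 'a::differential_algebra bkp_op \<Rightarrow> bool" where
  "order_le d P \<longleftrightarrow> (\<forall>m i. i > d \<longrightarrow> coeff_psdo (coeff_mfps P m) i = 0)"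

lemma order_le_mono: "order_le d P \<Longrightarrow> d \<le> e \<Longrightarrow> order_le e P"
  by (simp add: order_le_def)

lemma order_le_diff: "order_le d P \<Longrightarrow> order_le d Q \<Longrightarrow> order_le d (P - Q)"
  by (simp add: order_le_def)

lemma order_le_add: "order_le d P \<Longrightarrow> order_le d Q \<Longrightarrow> order_le d (P + Q)"
  by (simp add: order_le_def)

lemma order_le_uminus: "order_le d P \<Longrightarrow> order_le d (- P)"
  by (simp add: order_le_def)

lemma order_le_1: "order_le 0 1"
  by (simp add: order_le_def coeff_mfps_1 one_psdo.rep_eq)

lemma order_le_var: "order_le 0 (mfps_var v)"
  by (simp add: order_le_def coeff_mfps_monom one_psdo.rep_eq)

lemma order_le_mult:
  assumes "order_le d P" "order_le e Q"
  shows "order_le (d + e) (P * Q)"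
  unfolding order_le_def
proof (intro allI impI)
  fix m i assume i: "d + e < i"
  have "coeff_psdo (coeff_mfps P a * coeff_mfps Q b) i = 0" for a b
    by (rule coeff_psdo_mult_eq_0[OF _ _ i]) (use assms in \<open>auto simp: order_le_def\<close>)
  then show "coeff_psdo (coeff_mfps (P * Q) m) i = 0"
    by (simp add: coeff_mfps_mult coeff_psdo_sum case_prod_beta)
qed

lemma order_le_power: "order_le d P \<Longrightarrow> order_le (int n * d) (P ^ n)"
proof (induction n)
  case (Suc n)
  then show ?case using order_le_mult[of d P "int n * d" "P ^ n"] by (simp add: algebra_simps)
qed (simp add: order_le_1)

lemma order_le_imp_eq_0:
  assumes "\<And>n. order_le (- int n) P"
  shows "P = 0"
proof (rule mfps_eqI, rule psdo_eqI)
  fix m i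
  show "coeff_psdo (coeff_mfps P m) i = coeff_psdo (coeff_mfps 0 m) i"
    using assms[of "nat (1 - i)"] by (simp add: order_le_def)
qed

text \<open>Translates the normal form of \<Phi> in \<open>bkp_dressing\<close> into the order
  filtration.\<close>

lemma op_minus_eq_self_iff: "op_minus P = P \<longleftrightarrow> order_le (-1) P"
proof
  assume "op_minus P = P"
  then have "psdo_minus (coeff_mfps P m) = coeff_mfps P m" for m
    by (metis coeff_mfps_map op_minus_def)
  then show "order_le (-1) P"
    unfolding order_le_def by (metis coeff_psdo_minus linorder_not_less zless_imp_add1_zle ab_left_minus)
next
  assume "order_le (-1) P"
  then show "op_minus P = P"
    by (intro mfps_eqI psdo_eqI) (auto simp: op_minus_def coeff_psdo_minus order_le_def)
qed

lemma order_le_op_minus: "order_le (-1) (op_minus P)"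
  by (simp add: op_minus_idem flip: op_minus_eq_self_iff)

text \<open>The inverse is the geometric series in \<open>1 - P\<close>, which converges in the order filtration.\<close>

lemma order_le_invertible:
  assumes "order_le (-1) (P - 1)"
  obtains Q where "P * Q = 1" "Q * P = 1"
proof -
  define X where "X = 1 - P"
  have X: "order_le (-1) X"
    using order_le_uminus[OF assms] by (simp add: X_def)
  define S where "S N = (\<Sum>j<N. X ^ j)" for N
  have tail: "order_le (- int N) (X ^ N)" for N
    using order_le_power[OF X, of N] by simp
  \<comment> \<open>At \<partial>^i the partial sums no longer change once N \<ge> 1 - i, since
    \<open>X ^ N\<close> has order at most -N < i.\<close>
  have stable: "coeff_psdo (coeff_mfps (S N) m) i = coeff_psdo (coeff_mfps (S (nat (1 - i))) m) i"
    if "nat (1 - i) \<le> N" for N m i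
    using that
  proof (induction N rule: dec_induct)
    case (step N)
    then have "coeff_psdo (coeff_mfps (X ^ N) m) i = 0"
      using tail[of N] by (simp add: order_le_def)
    then show ?case using step by (simp add: S_def)
  qed simp
  define Q where "Q = Abs_mfps (\<lambda>m. Abs_psdo (\<lambda>i. coeff_psdo (coeff_mfps (S (nat (1 - i))) m) i))"
  have Q: "coeff_psdo (coeff_mfps Q m) i = coeff_psdo (coeff_mfps (S (nat (1 - i))) m) i" for m i
  proof -
    \<comment> \<open>For i > 0 the index \<open>nat (1 - i)\<close> is 0 and the partial sum is
      empty; thus \<open>Q\<close> has order at most 0.\<close>
    have "\<forall>i>0. coeff_psdo (coeff_mfps (S (nat (1 - i))) m) i = 0"
      by (simp add: S_def)
    then show ?thesis by (subst Q_def) (simp add: Abs_psdo_inverse exI[of _ 0])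
  qed
  have approx: "order_le (- int N) (Q - S N)" for N
    unfolding order_le_def
  proof (intro allI impI)
    fix m i assume "- int N < i"
    then show "coeff_psdo (coeff_mfps (Q - S N) m) i = 0"
      using stable[of i N m] by (simp add: Q)
  qed
  have P: "order_le 0 P"
    using order_le_diff[OF order_le_1 order_le_mono[OF X]] by (simp add: X_def)
  have left: "P * S N = 1 - X ^ N" for N
    by (induction N) (simp_all add: S_def X_def algebra_simps)
  have right: "S N * P = 1 - X ^ N" for N
  proof (induction N)
    case (Suc N)
    have "X ^ N * P = X ^ N - X ^ Suc N"
      by (subst power_Suc2) (simp add: X_def right_diff_distrib)
    with Suc show ?case by (simp add: S_def distrib_right)
  qed (simp add: S_def)
  show thesis
  proof
    have "order_le (- int N) (P * Q - 1)" for N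
    proof -
      \<comment> \<open>This operator is \<open>P * Q - 1\<close>, because
        \<open>P * S N = 1 - X ^ N\<close>.\<close>
      have "order_le (- int N) (P * (Q - S N) - X ^ N)"
        using order_le_mult[OF P approx] tail by (intro order_le_diff) simp_all
      then show ?thesis by (simp add: right_diff_distrib left)
    qed
    then show "P * Q = 1" using order_le_imp_eq_0[of "P * Q - 1"] by simp
    have "order_le (- int N) (Q * P - 1)" for N
    proof -
      have "order_le (- int N) ((Q - S N) * P - X ^ N)"
        using order_le_mult[OF approx P] tail by (intro order_le_diff) simp_all
      then show ?thesis by (simp add: left_diff_distrib right)
    qed
    then show "Q * P = 1" using order_le_imp_eq_0[of "Q * P - 1"] by simp
  qed
qed

text \<open>Two-sided inverses are unique, so the description in \<open>op_inv\<close> is well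
  defined.\<close>

lemma op_inv_eq: "P * Q = 1 \<Longrightarrow> Q * P = 1 \<Longrightarrow> op_inv P = Q"
  unfolding op_inv_def by (rule the_equality) (auto, metis mult.assoc mult_1_left mult_1_right)

lemma op_inv:
  assumes "order_le (-1) (P - 1)"
  shows "P * op_inv P = 1" "op_inv P * P = 1"
  using order_le_invertible[OF assms] op_inv_eq by metis+

section \<open>Powers of \<partial> and of the Lax operator\<close>

lemma del_mult: "del i * del j = del (i + j)"
  by (simp add: del_def mfps_monom_mult_const psdo_del_mult)

lemma del_0: "del 0 = 1"
  by (simp add: del_def psdo_del_0 mfps_monom_0_1)

lemma del_1_power: "del 1 ^ n = del (int n)"
  by (induction n) (simp_all add: del_0 del_mult)

text \<open>The inverse is \<partial>^(-1) dressed by \<Phi>. It enters \<open>B_op\<close> when the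
  power of \<open>L\<close> is 0.\<close>

lemma op_inv_lax_op:
  assumes "order_le (-1) (\<Phi> - 1)"
  shows "lax_op \<Phi> * op_inv (lax_op \<Phi>) = 1" "op_inv (lax_op \<Phi>) * lax_op \<Phi> = 1"
    "op_inv (lax_op \<Phi>) = \<Phi> * del (-1) * op_inv \<Phi>"
proof -
  note inv = op_inv[OF assms]
  have cancel: "op_inv \<Phi> * (\<Phi> * Z) = Z" "del i * (del (- i) * Z) = Z" for Z i
    by (simp_all add: inv del_mult del_0 flip: mult.assoc)
  have 1: "lax_op \<Phi> * (\<Phi> * del (-1) * op_inv \<Phi>) = 1"
    by (simp add: lax_op_def mult.assoc cancel cancel(2)[of 1] inv)
  have 2: "\<Phi> * del (-1) * op_inv \<Phi> * lax_op \<Phi> = 1"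
    using cancel(2)[of "-1"] by (simp add: lax_op_def mult.assoc cancel inv)
  show 3: "op_inv (lax_op \<Phi>) = \<Phi> * del (-1) * op_inv \<Phi>"
    by (rule op_inv_eq[OF 1 2])
  show "lax_op \<Phi> * op_inv (lax_op \<Phi>) = 1" "op_inv (lax_op \<Phi>) * lax_op \<Phi> = 1"
    by (simp_all add: 3 1 2)
qed

lemma lax_op_power:
  assumes "order_le (-1) (\<Phi> - 1)"
  shows "lax_op \<Phi> ^ n = \<Phi> * del 1 ^ n * op_inv \<Phi>"
proof (induction n)
  case (Suc n)
  have "op_inv \<Phi> * (\<Phi> * Z) = Z" for Z
    by (simp add: op_inv[OF assms] flip: mult.assoc)
  with Suc show ?case by (simp add: mult.assoc) (simp add: lax_op_def mult.assoc)
qed (simp add: op_inv[OF assms])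

section \<open>Time derivatives and the derivative at \<open>Eps\<close> = 0\<close>

lemma dt_1: "dt 1 P = del 1 * P - P * del 1"
  by (rule mfps_eqI)
    (simp add: dt_def del_def coeff_mfps_mult_monom_left coeff_mfps_mult_monom_right psdo_dx_eq_commutator)

lemma dt_pderiv: "n \<noteq> 1 \<Longrightarrow> dt n P = mfps_pderiv (Time n) P"
  by (simp add: dt_def)

interpretation dt: twisted_derivation "\<lambda>P. P" "dt n :: 'a::differential_algebra bkp_op \<Rightarrow> 'a bkp_op" for n
proof
  fix P Q :: "'a bkp_op"
  show "dt n (P - Q) = dt n P - dt n Q" "dt n (P * Q) = dt n P * Q + P * dt n Q"
    by (cases "n = 1"; simp add: dt_1 dt_pderiv mfps_pderiv_diff mfps_pderiv_mult algebra_simps del: One_nat_def)+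
qed simp_all

text \<open>Evaluating the product rule at \<open>Eps\<close> = 0 also evaluates the
  undifferentiated factor, which is the reason for \<open>hom\<close> in the locale.\<close>

interpretation at0: twisted_derivation "mfps_at0 v" "\<lambda>P. mfps_at0 v (mfps_pderiv v P)" for v
  by unfold_locales (simp_all add: mfps_at0_1 mfps_at0_diff mfps_at0_mult mfps_at0_add
      mfps_pderiv_diff mfps_pderiv_mult)

lemma dt_add: "dt n (P + Q) = dt n P + dt n Q"
  by (cases "n = 1") (simp_all add: dt_1 dt_pderiv mfps_pderiv_add algebra_simps del: One_nat_def)

lemma dt_op_minus: "dt n (op_minus P) = op_minus (dt n P)"
  by (rule mfps_eqI, rule psdo_eqI)
    (auto simp: dt_def op_minus_def psdo_dx.rep_eq coeff_psdo_minus coeff_mfps_pderiv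
      coeff_psdo_of_nat_mult distrib_right)

lemma at0_op_minus: "mfps_at0 v (op_minus P) = op_minus (mfps_at0 v P)"
  by (rule mfps_eqI, rule psdo_eqI) (simp add: op_minus_def coeff_psdo_minus coeff_mfps_at0)

lemma pderiv_op_minus: "mfps_pderiv v (op_minus P) = op_minus (mfps_pderiv v P)"
  by (rule mfps_eqI, rule psdo_eqI)
    (auto simp: op_minus_def coeff_psdo_minus coeff_mfps_pderiv coeff_psdo_of_nat_mult distrib_right)

text \<open>Continuity of \<open>dt n\<close>, as required by \<open>additive_mfps_sum\<close>; the
  two monomials cover both cases of its definition.\<close>

lemma coeff_dt_eq_0:
  fixes P :: "'a::differential_algebra bkp_op"
  assumes "\<forall>a\<in>{m, m + Poly_Mapping.single (Time n) 1}. coeff_mfps P a = 0"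
  shows "coeff_mfps (dt n P) m = 0"
proof -
  have "psdo_dx (0 :: 'a psdo) = 0" by (simp add: psdo_dx_eq_commutator)
  then show ?thesis using assms by (simp add: dt_def coeff_mfps_pderiv)
qed

text \<open>Continuity of multiplication by a fixed operator: a monomial has finitely many
  factors.\<close>

lemma coeff_mfps_mult_eq_0:
  assumes "\<forall>a\<in>{a. \<exists>b. a + b = m}. coeff_mfps P a = 0"
  shows "coeff_mfps (P * Q) m = 0" "coeff_mfps (Q * P) m = 0"
proof -
  have "coeff_mfps P a = 0" if "a + b = m \<or> b + a = m" for a b
    using assms that by (metis (mono_tags) add.commute mem_Collect_eq)
  then show "coeff_mfps (P * Q) m = 0" "coeff_mfps (Q * P) m = 0"
    unfolding coeff_mfps_mult
    by - (rule sum.neutral; clarsimp; metis mult_zero_left mult_zero_right)+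
qed

section \<open>The Orlov--Shulman operator and the additional flows\<close>

lemma Gamma_term_eq:
  assumes "odd i"
  shows "of_nat i * time x i * del (int i - 1)
    = (if i = 1 then mfps_const (psdo_fun x)
       else mfps_monom (Poly_Mapping.single (Time i) 1) (of_nat i * psdo_del (int i - 1)))"
  by (simp add: time_def del_0 of_nat_mult_mfps_monom del: One_nat_def)
    (simp add: del_def mfps_monom_mult_const)

text \<open>The summand 1 sits at the trivial monomial, any other summand \<open>i\<close> at
  \<open>Time i\<close>, which must then occur in \<open>m\<close>.\<close>

lemma finite_Gamma_term:
  "finite {i. coeff_mfps (if odd i then of_nat i * time x i * del (int i - 1) else 0) m \<noteq> 0}"
proof (rule finite_subset)
  show "finite (insert 1 (Time -` Poly_Mapping.keys m))"
    by (simp add: finite_vimageI inj_def)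
  show "{i. coeff_mfps (if odd i then of_nat i * time x i * del (int i - 1) else 0) m \<noteq> 0}
      \<subseteq> insert 1 (Time -` Poly_Mapping.keys m)"
    by (auto simp: Gamma_term_eq coeff_mfps_monom split: if_splits
        dest: arg_cong[where f = Poly_Mapping.keys])
qed

lemma mfps_pderiv_monom_single: "mfps_pderiv v (mfps_monom (Poly_Mapping.single v 1) a) = mfps_const a"
proof -
  have "mfps_monom (Poly_Mapping.single v 1) a = mfps_var v * mfps_const a"
    by (simp add: mfps_monom_mult_const)
  then show ?thesis
    by (simp only: mfps_pderiv_mult mfps_pderiv_var mfps_pderiv_eq_0[OF mfps_at0_monom]
        lookup_zero mult_1_left mult_zero_right add_0_right)
qed

text \<open>Only the summand \<open>n\<close> involves \<open>t_n\<close>; for \<open>n = 1\<close>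
  the variable is the function \<open>x\<close>, and \<open>dx x = 1\<close> is what differentiates
  it.\<close>

lemma dt_Gamma_op:
  fixes x :: "'a::differential_algebra"
  assumes "dx x = 1" "odd n"
  shows "dt n (Gamma_op x) = of_nat n * del (int n - 1)"
proof -
  let ?G = "\<lambda>i. if odd i then of_nat i * time x i * del (int i - 1) else 0"
  have "dt n (?G i) = 0" if "i \<noteq> n" for i
  proof (cases "odd i")
    case True
    show ?thesis
    proof (cases "n = 1")
      case True
      have "psdo_dx (of_nat i * psdo_del j) = (0 :: 'a psdo)" for j
        by (rule psdo_eqI) (simp add: psdo_dx.rep_eq coeff_psdo_of_nat_mult psdo_del.rep_eq dx_of_nat)
      then have "mfps_map psdo_dx (mfps_monom k (of_nat i * psdo_del j)) = (0 :: 'a bkp_op)" for k j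
        by (intro mfps_eqI) (simp add: coeff_mfps_monom psdo_dx_eq_commutator)
      then show ?thesis
        using \<open>odd i\<close> that True by (simp add: Gamma_term_eq dt_def del: One_nat_def)
    next
      case False
      show ?thesis
        unfolding dt_pderiv[OF False]
        by (rule mfps_pderiv_eq_0)
          (use \<open>odd i\<close> that in \<open>simp add: Gamma_term_eq mfps_at0_monom lookup_single when_def\<close>)
    qed
  qed (simp add: dt.der_0)
  then have "dt n (Gamma_op x) = (\<Sum>i\<in>{n}. dt n (?G i))"
    unfolding Gamma_op_def
    by (intro additive_mfps_sum finite_Gamma_term)
      (auto simp: dt_add intro!: exI[of _ "{m, m + Poly_Mapping.single (Time n) 1}" for m] coeff_dt_eq_0)
  also have "\<dots> = dt n (of_nat n * time x n * del (int n - 1))"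
    using assms(2) by simp
  also have "\<dots> = of_nat n * del (int n - 1)"
  proof (cases "n = 1")
    case True
    have "psdo_dx (psdo_fun x) = 1"
      by (rule psdo_eqI) (simp add: psdo_dx.rep_eq psdo_fun.rep_eq one_psdo.rep_eq assms(1))
    moreover have "psdo_dx (0 :: 'a psdo) = 0"
      by (simp add: psdo_dx_eq_commutator)
    ultimately show ?thesis
      using True
      by (intro mfps_eqI) (simp add: dt_def time_def del_0 coeff_mfps_monom coeff_mfps_1)
  next
    case False
    then show ?thesis
      unfolding Gamma_term_eq[OF assms(2)]
      by (simp add: dt_pderiv mfps_pderiv_monom_single del_def of_nat_mult_mfps_monom del: One_nat_def)
  qed
  finally show ?thesis .
qed

text \<open>As \<open>dt 1\<close> is the commutator with \<partial>, the case \<open>n = 1\<close>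
  of \<open>dt_Gamma_op\<close> reads [\<partial>, \<Gamma>] = 1. Induction gives
  [\<partial>^k, \<Gamma>] = k \<partial>^(k-1), the value of the time derivative at
  \<open>k = n\<close>.\<close>

lemma dt_Gamma_op_commutator:
  fixes x :: "'a::differential_algebra"
  assumes "dx x = 1" "odd n"
  shows "dt n (Gamma_op x) = del 1 ^ n * Gamma_op x - Gamma_op x * del 1 ^ n"
proof -
  have comm: "del 1 * Gamma_op x = Gamma_op x * del 1 + 1"
    using dt_Gamma_op[OF assms(1), of 1] by (simp add: dt_1 del_0 algebra_simps del: One_nat_def)
  have "del 1 ^ k * Gamma_op x - Gamma_op x * del 1 ^ k = of_nat k * del (int k - 1)" for k
  proof (induction k)
    case (Suc k)
    have "del 1 ^ Suc k * Gamma_op x - Gamma_op x * del 1 ^ Suc k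
        = del 1 * (del 1 ^ k * Gamma_op x - Gamma_op x * del 1 ^ k)
          + (del 1 * Gamma_op x - Gamma_op x * del 1) * del 1 ^ k"
      by (simp add: algebra_simps)
    also have "\<dots> = of_nat k * (del 1 * del (int k - 1)) + del 1 ^ k"
      by (simp add: Suc comm) (metis mult.assoc mult_of_nat_commute)
    finally show ?case
      by (simp add: del_mult del_1_power distrib_right add.commute)
  qed simp
  then show ?thesis by (simp add: dt_Gamma_op[OF assms])
qed

lemma at0_Gamma_op: "mfps_at0 Eps (Gamma_op x) = Gamma_op x"
  unfolding Gamma_op_def
  by (intro mfps_at0_sum finite_Gamma_term)
    (auto simp: Gamma_term_eq mfps_at0_monom lookup_single at0.hom_0)

text \<open>The property \<open>C\<close> is left abstract to serve twice: for operators evolving by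
  a commutator and for operators free of \<open>Eps\<close>.\<close>

lemma B_op_closed:
  assumes "C 1" "\<And>P Q. C P \<Longrightarrow> C Q \<Longrightarrow> C (P - Q)" "\<And>P Q. C P \<Longrightarrow> C Q \<Longrightarrow> C (P * Q)"
    and "C (lax_op \<Phi>)" "C (op_inv (lax_op \<Phi>))" "C (orlov_shulman x \<Phi>)"
  shows "C (B_op x m n \<Phi>)"
proof -
  have pow: "C (P ^ k)" if "C P" for P k
    using that by (induction k) (simp_all add: assms(1,3))
  \<comment> \<open>Closure is assumed for differences only, so the sign \<open>-1\<close> is
    reached as (1 - 1) - 1.\<close>
  have "C 0"
    using assms(2)[OF assms(1,1)] by simp
  then have "C (-1)"
    using assms(2)[OF _ assms(1), of 0] by simp
  then show ?thesis
    unfolding B_op_def Let_def op_powi_def by (simp add: assms pow)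
qed

text \<open>The exponents of \<open>ExpM\<close> and \<open>LogQ\<close> in \<open>m\<close> bound
  \<open>p\<close> and \<open>s\<close>, whatever \<open>B\<close> is.\<close>

lemma finite_D_term:
  fixes B :: "nat \<Rightarrow> nat \<Rightarrow> 'a::differential_algebra bkp_op"
  shows "finite {i. coeff_mfps (case i of (p, s) \<Rightarrow>
    mfps_monom (Poly_Mapping.single ExpM p + Poly_Mapping.single LogQ s) (c p s) * B p s) m \<noteq> 0}"
proof (rule finite_subset)
  show "finite ({..Poly_Mapping.lookup m ExpM} \<times> {..Poly_Mapping.lookup m LogQ})"
    by simp
qed (auto simp: coeff_mfps_mult_monom_left lookup_add lookup_single split: if_splits)

text \<open>The map \<open>?T\<close> measures the failure of the commutator equation. It is
  additive and continuous and kills each summand, hence also the series.\<close>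

lemma inner_dt_D_op:
  fixes \<Phi> :: "'a::differential_algebra bkp_op"
  assumes "\<And>p s. dt.inner n A (B_op x p s \<Phi>)"
  shows "dt.inner n A (D_op x m k \<Phi>)"
proof -
  let ?T = "\<lambda>P. dt n P - (A * P - P * A)"
  \<comment> \<open>The prefactor is a constant times indeterminates other than times: it is central
    and \<open>dt n\<close> annihilates it.\<close>
  have monom: "dt.inner n A (mfps_monom (Poly_Mapping.single ExpM p + Poly_Mapping.single LogQ s)
      (psdo_fun (of_real c)))" (is "dt.inner n A (mfps_monom ?k ?c)") for p s c
  proof -
    have "dt n (mfps_monom ?k ?c) = 0"
    proof (cases "n = 1")
      case True
      then show ?thesis
        by (intro mfps_eqI) (simp add: dt_def coeff_mfps_monom psdo_dx_eq_commutator
            psdo_fun_of_real_commute)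
    next
      case False
      then show ?thesis
        by (simp add: dt_pderiv mfps_pderiv_eq_0[OF mfps_at0_monom] lookup_add lookup_single)
    qed
    moreover have "A * mfps_monom ?k ?c = mfps_monom ?k ?c * A"
      by (rule mfps_eqI) (simp add: coeff_mfps_mult_monom_left coeff_mfps_mult_monom_right
          psdo_fun_of_real_commute)
    ultimately show ?thesis by (simp add: dt.inner_def)
  qed
  have "\<exists>S. finite S \<and> (\<forall>P. (\<forall>a\<in>S. coeff_mfps P a = 0) \<longrightarrow> coeff_mfps (?T P) a0 = 0)" for a0
    by (rule exI[of _ "{a0, a0 + Poly_Mapping.single (Time n) 1} \<union> {a. \<exists>b. a + b = a0}"])
      (auto simp: finite_monomial_factors coeff_dt_eq_0 coeff_mfps_mult_eq_0)
  then have "?T (D_op x m k \<Phi>) = (\<Sum>i\<in>{}. ?T (case i of (p, s) \<Rightarrow>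
     mfps_monom (Poly_Mapping.single ExpM p + Poly_Mapping.single LogQ s)
       (psdo_fun (of_real (real m ^ p * real k ^ s / (fact p * fact s)))) * B_op x p s \<Phi>))"
    unfolding D_op_def
    using dt.inner_mult[OF monom assms]
    by (intro additive_mfps_sum finite_D_term) (auto simp: dt_add algebra_simps dt.inner_def)
  then show ?thesis by (simp add: dt.inner_def)
qed

lemma at0_D_op:
  assumes "\<And>p s. mfps_at0 Eps (B_op x p s \<Phi>) = B_op x p s \<Phi>"
  shows "mfps_at0 Eps (D_op x m k \<Phi>) = D_op x m k \<Phi>"
  unfolding D_op_def
  by (intro mfps_at0_sum finite_D_term)
    (auto simp: mfps_at0_mult assms mfps_at0_monom lookup_add lookup_single)

section \<open>Evolution under the time flows and the additional flows\<close>

lemma depends_on_times_at0_Eps: "depends_on_times P \<Longrightarrow> mfps_at0 Eps P = P"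
  by (rule mfps_eqI) (auto simp: depends_on_times_def coeff_mfps_at0 in_keys_iff subset_iff)

text \<open>Apply \<open>inner_conj\<close> with \<partial>^n, whose dressing is L^n; subtracting
  (L^n)_- leaves (L^n)_+. It is used for \<partial> and \<Gamma>, that is, for L and M.\<close>

lemma inner_dt_dressed:
  assumes "order_le (-1) (\<Phi> - 1)" "dt n \<Phi> = - op_minus (lax_op \<Phi> ^ n) * \<Phi>"
    and "dt n X = del 1 ^ n * X - X * del 1 ^ n"
  shows "dt.inner n (op_plus (lax_op \<Phi> ^ n)) (\<Phi> * X * op_inv \<Phi>)"
  using dt.inner_conj[OF op_inv[OF assms(1)] assms(2,3)]
  by (simp add: op_plus_def lax_op_power[OF assms(1)])

lemma inner_dt_op_plus_D_op:
  assumes "dx x = 1" "odd n" "order_le (-1) (\<Phi> - 1)" "dt n \<Phi> = - op_minus (lax_op \<Phi> ^ n) * \<Phi>"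
  shows "dt.inner n (op_plus (lax_op \<Phi> ^ n)) (D_op x m k \<Phi>)"
proof -
  have L: "dt.inner n (op_plus (lax_op \<Phi> ^ n)) (lax_op \<Phi>)"
  proof -
    have "dt n (del 1) = 0"
    proof (cases "n = 1")
      case False
      then show ?thesis
        by (simp add: dt_pderiv del_def mfps_pderiv_eq_0[OF mfps_at0_monom])
    qed (simp add: dt_1 del: One_nat_def)
    then have "dt.inner n (op_plus (lax_op \<Phi> ^ n)) (\<Phi> * del 1 * op_inv \<Phi>)"
      by (intro inner_dt_dressed assms) (simp add: power_commutes)
    then show ?thesis by (simp flip: lax_op_def)
  qed
  have M: "dt.inner n (op_plus (lax_op \<Phi> ^ n)) (orlov_shulman x \<Phi>)"
    unfolding orlov_shulman_def
    by (intro inner_dt_dressed assms dt_Gamma_op_commutator)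
  have "dt.inner n (op_plus (lax_op \<Phi> ^ n)) (B_op x p s \<Phi>)" for p s
    using dt.inner_1 dt.inner_diff dt.inner_mult L
      dt.inner_inverse[OF op_inv_lax_op(1,2)[OF assms(3)] L] M
    by (rule B_op_closed)
  then show ?thesis by (rule inner_dt_D_op)
qed

text \<open>Needed so that differentiating the perturbation \<Phi> + \<open>Eps\<close> V at
  \<open>Eps\<close> = 0 returns V itself.\<close>

lemma at0_additional_flow:
  assumes "order_le (-1) (\<Phi> - 1)" "mfps_at0 Eps \<Phi> = \<Phi>"
  shows "mfps_at0 Eps (additional_flow x m k \<Phi>) = additional_flow x m k \<Phi>"
proof -
  have del: "mfps_at0 Eps (del j) = del j" for j
    by (simp add: del_def mfps_at0_monom)
  have inv: "mfps_at0 Eps (op_inv \<Phi>) = op_inv \<Phi>"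
    by (rule op_inv_eq[symmetric]; metis assms(2) op_inv[OF assms(1)] mfps_at0_1 mfps_at0_mult)
  have "mfps_at0 Eps (B_op x p s \<Phi>) = B_op x p s \<Phi>" for p s
    by (rule B_op_closed) (simp_all add: mfps_at0_1 mfps_at0_diff mfps_at0_mult
        op_inv_lax_op(3)[OF assms(1)], simp_all add: lax_op_def orlov_shulman_def mfps_at0_mult
        del inv assms(2) at0_Gamma_op)
  then show ?thesis
    by (simp add: additional_flow_def mfps_at0_mult mfps_at0_uminus at0_op_minus at0_D_op assms(2))
qed

text \<open>By \<open>inner_conj\<close> with \<open>D = 0\<close>, the Lax operator and its powers
  change by the commutator with \<open>- op_minus E\<close>; the product rule applied to
  \<open>bkp_flow\<close> does the rest.\<close>

lemma flow_derivative_bkp_flow: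
  fixes n :: nat
  assumes "order_le (-1) (\<Phi> - 1)" "mfps_at0 Eps \<Phi> = \<Phi>"
    and V: "V \<Phi> = - op_minus E * \<Phi>" "mfps_at0 Eps (V \<Phi>) = V \<Phi>"
  defines "A \<equiv> lax_op \<Phi> ^ n"
  shows "flow_derivative V (bkp_flow n) \<Phi>
    = (op_minus (op_minus E * A - A * op_minus E) + op_minus A * op_minus E) * \<Phi>"
proof -
  define F where "F = \<Phi> + mfps_var Eps * V \<Phi>"
  let ?h = "mfps_at0 Eps" and ?d = "\<lambda>P. mfps_at0 Eps (mfps_pderiv Eps P)"
  have hF: "?h F = \<Phi>"
    by (simp add: F_def mfps_at0_add mfps_at0_mult mfps_at0_var assms(2) del: One_nat_def)
  have dF: "?d F = - op_minus E * \<Phi>"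
    by (simp add: F_def mfps_pderiv_add mfps_pderiv_mult mfps_pderiv_var mfps_at0_add mfps_at0_mult
        mfps_at0_var mfps_pderiv_eq_0[OF assms(2)] at0.hom_0 V(2) del: One_nat_def) (simp add: V(1))
  \<comment> \<open>The perturbation must keep the form 1 + (negative order), so that
    \<open>F\<close> has a genuine inverse.\<close>
  have "order_le 0 \<Phi>"
    using order_le_add[OF order_le_mono[OF assms(1)] order_le_1] by simp
  then have "order_le (-1) (V \<Phi>)"
    using order_le_mult[OF order_le_uminus[OF order_le_op_minus], of 0 \<Phi> E] by (simp add: V(1))
  then have "order_le (-1) ((\<Phi> - 1) + mfps_var Eps * V \<Phi>)"
    using order_le_mult[OF order_le_var, of "-1" "V \<Phi>" Eps] by (intro order_le_add assms(1)) simp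
  then have F: "order_le (-1) (F - 1)"
    by (simp add: F_def algebra_simps)
  \<comment> \<open>Setting \<open>Eps\<close> to 0 is multiplicative, so it maps the inverse of
    \<open>F\<close> to the inverse of \<Phi>.\<close>
  have hinv: "?h (op_inv F) = op_inv \<Phi>"
    using op_inv[OF F] by (intro op_inv_eq[symmetric])
      (simp_all add: mfps_at0_1 flip: hF mfps_at0_mult)
  have hdel: "?h (del 1) = del 1"
    by (simp add: del_def mfps_at0_monom)
  have hL: "?h (lax_op F) = lax_op \<Phi>"
    by (simp add: lax_op_def mfps_at0_mult hF hinv hdel)
  have "at0.inner Eps (?h F * 0 * ?h (op_inv F) - op_minus E) (F * del 1 * op_inv F)"
    by (rule at0.inner_conj[OF op_inv[OF F]])
      (simp_all add: dF hF mfps_pderiv_eq_0[OF hdel] at0.hom_0)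
  then have "at0.inner Eps (- op_minus E) (lax_op F ^ n)"
    by (intro at0.inner_power) (simp add: lax_op_def)
  then have dA: "?d (lax_op F ^ n) = A * op_minus E - op_minus E * A"
    by (simp add: at0.inner_def mfps_at0_power hL A_def)
  \<comment> \<open>The negation is written as a difference from 0, the form to which
    \<open>der_diff\<close> applies.\<close>
  have "flow_derivative V (bkp_flow n) \<Phi> = ?d (0 - op_minus (lax_op F ^ n) * F)"
    by (simp add: flow_derivative_def bkp_flow_def F_def)
  also have "\<dots> = - (?d (op_minus (lax_op F ^ n)) * \<Phi> + ?h (op_minus (lax_op F ^ n)) * ?d F)"
    unfolding at0.der_diff at0.der_mult by (simp only: at0.der_0 hF diff_0)
  also have "?d (op_minus (lax_op F ^ n)) = op_minus (A * op_minus E - op_minus E * A)"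
    by (simp add: pderiv_op_minus at0_op_minus dA)
  also have "?h (op_minus (lax_op F ^ n)) = op_minus A"
    by (simp add: at0_op_minus mfps_at0_power hL A_def)
  finally show ?thesis
    by (simp add: dF op_minus_diff algebra_simps)
qed

theorem theorem6p2:
  fixes x :: "'a::differential_algebra" and L \<Phi> :: "'a bkp_op" and l k n :: nat
  assumes "dx x = 1"
    and "bkp_lax L"
    and "bkp_dressing L \<Phi>"
    and "odd n"
  shows "flow_derivative (additional_flow x l k) (bkp_flow n) \<Phi> = dt n (additional_flow x l k \<Phi>)"
proof -
  have \<Phi>: "order_le (-1) (\<Phi> - 1)" and dt\<Phi>: "dt n \<Phi> = - op_minus (lax_op \<Phi> ^ n) * \<Phi>"
    and at0: "mfps_at0 Eps \<Phi> = \<Phi>"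
    using assms(3,4) depends_on_times_at0_Eps
    by (auto simp: bkp_dressing_def op_minus_eq_self_iff lax_op_def)
  define A where "A = lax_op \<Phi> ^ n"
  define D where "D = D_op x l k \<Phi>"
  define E where "E = op_minus D"
  define N where "N = op_minus A"
  define K where "K = op_plus A"
  have A: "A = K + N"
    by (simp add: K_def N_def op_plus_def)
  have D: "D = op_plus D + E"
    by (simp add: E_def op_plus_def)
  have flow: "additional_flow x l k \<Phi> = - E * \<Phi>"
    by (simp add: additional_flow_def E_def D_def)
  have dtD: "dt n D = K * D - D * K"
    using inner_dt_op_plus_D_op[OF assms(1,4) \<Phi> dt\<Phi>, of l k] by (simp add: dt.inner_def D_def K_def A_def)
  \<comment> \<open>Both factors are differential operators, so inside the projected commutator
    \<open>D\<close> may be replaced by \<open>E\<close>.\<close>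
  have "op_minus (K * op_plus D) = 0" "op_minus (op_plus D * K) = 0"
    by (simp_all add: op_minus_mult_eq_0 K_def op_minus_op_plus)
  then have KD: "op_minus (K * D - D * K) = op_minus (K * E - E * K)"
    by (subst (1 2) D) (simp add: algebra_simps op_minus_add op_minus_diff)
  \<comment> \<open>Products of two operators of order at most -1 have order at most -2, hence the
    projection fixes them.\<close>
  have "order_le (-1) (E * N)" "order_le (-1) (N * E)"
    unfolding E_def N_def
    by (rule order_le_mono[OF order_le_mult[OF order_le_op_minus order_le_op_minus]]; simp)+
  then have EN: "op_minus (E * N) = E * N" "op_minus (N * E) = N * E"
    by (simp_all add: op_minus_eq_self_iff)
  have "dt n (additional_flow x l k \<Phi>) = dt n (0 - E * \<Phi>)"
    by (simp add: flow)
  also have "\<dots> = - (dt n E * \<Phi> + E * (- N * \<Phi>))"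
    unfolding dt.der_diff dt.der_mult by (simp only: dt.der_0 diff_0 dt\<Phi> N_def A_def)
  also have "dt n E = op_minus (K * E - E * K)"
    by (simp add: E_def dt_op_minus dtD flip: KD) (simp add: KD E_def)
  finally have right: "dt n (additional_flow x l k \<Phi>) = (op_minus (E * K - K * E) + E * N) * \<Phi>"
    by (simp add: op_minus_diff algebra_simps)
  have "flow_derivative (additional_flow x l k) (bkp_flow n) \<Phi>
      = (op_minus (E * A - A * E) + N * E) * \<Phi>"
    using flow_derivative_bkp_flow[where V = "additional_flow x l k",
        OF \<Phi> at0 flow[unfolded E_def] at0_additional_flow[OF \<Phi> at0]]
    by (simp only: E_def N_def A_def)
  \<comment> \<open>The part [E, N] passes through the projection unchanged, and its term
    \<open>- N * E\<close> cancels the extra \<open>N * E\<close>.\<close>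
  also have "op_minus (E * A - A * E) = op_minus (E * K - K * E) + E * N - N * E"
    by (simp add: A algebra_simps op_minus_add op_minus_diff EN)
  finally show ?thesis
    by (simp add: right)
qed

end
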